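(* If there is an algorithm that solves List Allocation in $T(n,w(I))$ steps on instances $I$ with $n$ vertices, then there exists an algorithm that solves Min-Max Multiway Cut in $2^{O(r\cdot \min\{\ell\cdot \log r,\ r\cdot \log \ell\})}\cdot T(n,r\ell)$ steps.
   Context: Graphs are loopless and may have multiple edges. For disjoint $X,Y\subseteq V(G)$, $\delta_G(X,Y)$ is the set of edges with one endpoint in $X$ and the other in $Y$. An $r$-allocation of a set $S$ is an $r$-tuple $\mathcal{V}=(\mathcal{V}^{(1)},\ldots,\mathcal{V}^{(r)})$ of pairwise disjoint, possibly empty, sets whose union is $S$. List Allocation. Input: $I=(G,r,\lambda,\alpha)$ with $r\geq1$, $\lambda:V(G)\to 2^{[r]}$, $\alpha:\binom{[r]}{2}\to\mathbb{Z}_{\geq 0}$. Output: an $r$-allocation $\mathcal{V}$ of $V(G)$ with $|\delta_G(\mathcal{V}^{(i)},\mathcal{V}^{(j)})|=\alpha(i,j)$ for all distinct $i,j$ and $v\in\mathcal{V}^{(i)}\Rightarrow i\in\lambda(v)$, or a correct report that none exists. Here $w(I)=\sum_{\{i,j\}}\alpha(i,j)$. Min-Max Multiway Cut. Input: $(G,\ell,r,T)$ with $G$ undirected, $\ell,r\in\mathbb{Z}_{\geq0}$, $T\subseteq V(G)$, $|T|=r$. Output: a partition $\{P_1,\ldots,P_r\}$ of $V(G)$ with $|P_i\cap T|=1$ and at most $\ell$ edges having exactly one endpoint in $P_i$, for each $i$; or a correct report that none exists. $n=|V(G)|$.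
   Formalization: The exponent bound O(r·min{ℓ log r, r log ℓ}) is stated uniformly for r, ℓ ≥ 2; for r < 2 or ℓ < 2, where the formula contains log 0 or vanishes and leaves no constant factor, the exponent is O(1 + r·ℓ·log r) instead. *)

theory Defs
  imports Complex_Main "HOL-Library.Disjoint_Sets" "HOL-Library.Landau_Symbols"
begin

section \<open>Multigraphs\<close>

record ('v, 'e) mgraph =
  verts :: "'v set"
  edges :: "'e set"
  ends :: "'e \<Rightarrow> 'v set"

definition wf_mgraph :: "('v, 'e) mgraph \<Rightarrow> bool" where
  "wf_mgraph G \<longleftrightarrow> finite (verts G) \<and> finite (edges G) \<and>
     (\<forall>e\<in>edges G. ends G e \<subseteq> verts G \<and> card (ends G e) = 2)"

definition delta :: "('v, 'e) mgraph \<Rightarrow> 'v set \<Rightarrow> 'v set \<Rightarrow> 'e set" where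
  "delta G X Y = {e \<in> edges G. \<exists>x\<in>X. \<exists>y\<in>Y. ends G e = {x, y}}"

section \<open>List Allocation\<close>

definition allocation :: "nat \<Rightarrow> 'v set \<Rightarrow> (nat \<Rightarrow> 'v set) \<Rightarrow> bool" where
  "allocation r S \<V> \<longleftrightarrow> disjoint_family_on \<V> {1..r} \<and> (\<Union>i\<in>{1..r}. \<V> i) = S"

text \<open>The weight function \<open>\<alpha>\<close> lives on two-element subsets of \<open>{1..r}\<close>; its values on other sets
  are never used.\<close>

definition la_instance :: "('v, 'e) mgraph \<Rightarrow> nat \<Rightarrow> ('v \<Rightarrow> nat set) \<Rightarrow> bool" where
  "la_instance G r lam \<longleftrightarrow> wf_mgraph G \<and> 1 \<le> r \<and> (\<forall>v\<in>verts G. lam v \<subseteq> {1..r})"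

definition la_solution ::
    "('v, 'e) mgraph \<Rightarrow> nat \<Rightarrow> ('v \<Rightarrow> nat set) \<Rightarrow> (nat set \<Rightarrow> nat) \<Rightarrow> (nat \<Rightarrow> 'v set) \<Rightarrow> bool" where
  "la_solution G r lam \<alpha> \<V> \<longleftrightarrow>
     allocation r (verts G) \<V> \<and>
     (\<forall>i\<in>{1..r}. \<forall>j\<in>{1..r}. i \<noteq> j \<longrightarrow> card (delta G (\<V> i) (\<V> j)) = \<alpha> {i, j}) \<and>
     (\<forall>i\<in>{1..r}. \<forall>v\<in>\<V> i. i \<in> lam v)"

definition la_weight :: "nat \<Rightarrow> (nat set \<Rightarrow> nat) \<Rightarrow> nat" where
  "la_weight r \<alpha> = (\<Sum>p | p \<subseteq> {1..r} \<and> card p = 2. \<alpha> p)"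

section \<open>Min-Max Multiway Cut\<close>

definition mmc_instance :: "('v, 'e) mgraph \<Rightarrow> nat \<Rightarrow> 'v set \<Rightarrow> bool" where
  "mmc_instance G r X \<longleftrightarrow> wf_mgraph G \<and> X \<subseteq> verts G \<and> card X = r"

definition mmc_solution ::
    "('v, 'e) mgraph \<Rightarrow> nat \<Rightarrow> nat \<Rightarrow> 'v set \<Rightarrow> 'v set set \<Rightarrow> bool" where
  "mmc_solution G l r X \<P> \<longleftrightarrow>
     partition_on (verts G) \<P> \<and> card \<P> = r \<and>
     (\<forall>P\<in>\<P>. card (P \<inter> X) = 1 \<and> card {e \<in> edges G. card (ends G e \<inter> P) = 1} \<le> l)"

section \<open>Algorithms\<close>

text \<open>
  Algorithms are programs of a unit-cost random access machine in the style of Cook and Reckhow,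
  presented with structured control flow: natural-number registers, arrays indexed by
  natural numbers, and as arithmetic only addition and truncated subtraction. A program mentions
  finitely many registers and arrays.
\<close>

type_synonym vname = string

record state =
  regs :: "vname \<Rightarrow> nat"
  arrs :: "vname \<Rightarrow> nat \<Rightarrow> nat"

datatype com =
    Skip
  | Const vname nat
  | Add vname vname vname
  | Sub vname vname vname
  | Load vname vname vname
  | Store vname vname vname
  | Seq com com
  | IfNZ vname com com
  | WhileNZ vname com

text \<open>\<open>exec c s k s'\<close>: started in \<open>s\<close>, program \<open>c\<close> halts in \<open>s'\<close> after exactly \<open>k\<close> steps.
  Every basic instruction and every test of a register against \<open>0\<close> is one step.\<close>

inductive exec :: "com \<Rightarrow> state \<Rightarrow> nat \<Rightarrow> state \<Rightarrow> bool" where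
  Skip: "exec Skip s 1 s"
| Const: "exec (Const x c) s 1 (s\<lparr>regs := (regs s)(x := c)\<rparr>)"
| Add: "exec (Add x y z) s 1 (s\<lparr>regs := (regs s)(x := regs s y + regs s z)\<rparr>)"
| Sub: "exec (Sub x y z) s 1 (s\<lparr>regs := (regs s)(x := regs s y - regs s z)\<rparr>)"
| Load: "exec (Load x a y) s 1 (s\<lparr>regs := (regs s)(x := arrs s a (regs s y))\<rparr>)"
| Store: "exec (Store a x y) s 1
    (s\<lparr>arrs := (arrs s)(a := (arrs s a)(regs s x := regs s y))\<rparr>)"
| Seq: "exec c1 s k1 s' \<Longrightarrow> exec c2 s' k2 s'' \<Longrightarrow> exec (Seq c1 c2) s (k1 + k2) s''"
| IfTrue: "regs s x \<noteq> 0 \<Longrightarrow> exec c1 s k s' \<Longrightarrow> exec (IfNZ x c1 c2) s (1 + k) s'"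
| IfFalse: "regs s x = 0 \<Longrightarrow> exec c2 s k s' \<Longrightarrow> exec (IfNZ x c1 c2) s (1 + k) s'"
| WhileTrue: "regs s x \<noteq> 0 \<Longrightarrow> exec c s k1 s' \<Longrightarrow> exec (WhileNZ x c) s' k2 s'' \<Longrightarrow>
    exec (WhileNZ x c) s (1 + k1 + k2) s''"
| WhileFalse: "regs s x = 0 \<Longrightarrow> exec (WhileNZ x c) s 1 s"

inductive_cases exec_elims:
  "exec Skip s k s'" "exec (Const x c) s k s'" "exec (Add x y z) s k s'" "exec (Sub x y z) s k s'"
  "exec (Load x a y) s k s'" "exec (Store a x y) s k s'"
inductive_cases SeqE: "exec (Seq c1 c2) s k s'"
inductive_cases IfE: "exec (IfNZ x c1 c2) s k s'"
inductive_cases WhileE: "exec (WhileNZ x c) s k s'"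

lemma exec_deterministic:
  "exec c s k s' \<Longrightarrow> exec c s k2 s2 \<Longrightarrow> k2 = k \<and> s2 = s'"
proof (induction arbitrary: k2 s2 rule: exec.induct)
  case Seq
  from Seq.prems show ?case by (rule SeqE) (metis Seq.IH)
next
  case IfTrue
  from IfTrue.prems show ?case by (rule IfE) (use IfTrue.IH IfTrue.hyps(1) in fastforce)+
next
  case IfFalse
  from IfFalse.prems show ?case by (rule IfE) (use IfFalse.IH IfFalse.hyps(1) in fastforce)+
next
  case WhileTrue
  from WhileTrue.prems show ?case by (rule WhileE) (use WhileTrue.IH WhileTrue.hyps(1) in fastforce)+
next
  case WhileFalse
  from WhileFalse.prems show ?case by (rule WhileE) (use WhileFalse.hyps in simp_all)
qed (erule exec_elims; simp)+

section \<open>Input and output conventions\<close>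

text \<open>
  Vertices are numbered \<open>0, \<dots>, n - 1\<close>. A graph is given by its (row-major) matrix of edge
  multiplicities; an edge list would make it impossible to bound running times in \<open>n\<close> without
  the number of parallel edges. Labels are \<open>1, \<dots>, r\<close>; the index maps \<open>(v, i) \<mapsto> v * r + i\<close> and
  \<open>(i, j) \<mapsto> i * r + j\<close> are injective for \<open>i\<close>, \<open>j\<close> in that range.
  The predicates constrain the input cells only: all other memory holds
  arbitrary values when a program starts.
\<close>

definition enc_graph :: "(nat, 'e) mgraph \<Rightarrow> state \<Rightarrow> bool" where
  "enc_graph G s \<longleftrightarrow> (let n = card (verts G) in
     verts G = {..<n} \<and> regs s ''n'' = n \<and>
     (\<forall>u<n. \<forall>v<n. arrs s ''G'' (u * n + v) = card (delta G {u} {v})))"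

definition enc_la ::
    "(nat, 'e) mgraph \<Rightarrow> nat \<Rightarrow> (nat \<Rightarrow> nat set) \<Rightarrow> (nat set \<Rightarrow> nat) \<Rightarrow> state \<Rightarrow> bool" where
  "enc_la G r lam \<alpha> s \<longleftrightarrow> enc_graph G s \<and> regs s ''r'' = r \<and>
     (\<forall>v\<in>verts G. \<forall>i\<in>{1..r}. arrs s ''lambda'' (v * r + i) = (if i \<in> lam v then 1 else 0)) \<and>
     (\<forall>i\<in>{1..r}. \<forall>j\<in>{1..r}. i \<noteq> j \<longrightarrow> arrs s ''alpha'' (i * r + j) = \<alpha> {i, j})"

definition enc_mmc :: "(nat, 'e) mgraph \<Rightarrow> nat \<Rightarrow> nat \<Rightarrow> nat set \<Rightarrow> state \<Rightarrow> bool" where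
  "enc_mmc G l r X s \<longleftrightarrow> enc_graph G s \<and> regs s ''l'' = l \<and> regs s ''r'' = r \<and>
     (\<forall>v\<in>verts G. arrs s ''T'' v = (if v \<in> X then 1 else 0))"

definition out_class :: "(nat, 'e) mgraph \<Rightarrow> state \<Rightarrow> nat \<Rightarrow> nat set" where
  "out_class G s i = {v \<in> verts G. arrs s ''out'' v = i}"

definition la_correct ::
    "(nat, 'e) mgraph \<Rightarrow> nat \<Rightarrow> (nat \<Rightarrow> nat set) \<Rightarrow> (nat set \<Rightarrow> nat) \<Rightarrow> state \<Rightarrow> bool" where
  "la_correct G r lam \<alpha> s \<longleftrightarrow>
     regs s ''ans'' = 1 \<and> la_solution G r lam \<alpha> (out_class G s) \<or>
     regs s ''ans'' = 0 \<and> (\<nexists>\<V>. la_solution G r lam \<alpha> \<V>)"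

definition mmc_correct :: "(nat, 'e) mgraph \<Rightarrow> nat \<Rightarrow> nat \<Rightarrow> nat set \<Rightarrow> state \<Rightarrow> bool" where
  "mmc_correct G l r X s \<longleftrightarrow>
     regs s ''ans'' = 1 \<and> mmc_solution G l r X (out_class G s ` {1..r}) \<or>
     regs s ''ans'' = 0 \<and> (\<nexists>\<P>. mmc_solution G l r X \<P>)"

section \<open>Solving a problem within a time bound\<close>

text \<open>
  The tables for \<open>\<lambda>\<close> and \<open>\<alpha>\<close> have about \<open>n * r + r\<^sup>2\<close> cells, so no program meets a bound in \<open>n\<close>
  and the total weight alone uniformly in \<open>r\<close>. A solver has to be correct for all \<open>r\<close>, but is
  held to its time bound only if \<open>r \<le> n + 1\<close> (at most \<open>n\<close> classes can be nonempty). Edges are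
  natural numbers without loss of generality, since the encoding forgets their identity.
\<close>

definition solves_list_allocation :: "com \<Rightarrow> (nat \<Rightarrow> nat \<Rightarrow> real) \<Rightarrow> bool" where
  "solves_list_allocation c T \<longleftrightarrow>
     (\<forall>(G :: (nat, nat) mgraph) r lam \<alpha> s.
        la_instance G r lam \<and> enc_la G r lam \<alpha> s \<longrightarrow>
        (\<exists>k s'. exec c s k s' \<and> la_correct G r lam \<alpha> s' \<and>
           (r \<le> card (verts G) + 1 \<longrightarrow> real k \<le> T (card (verts G)) (la_weight r \<alpha>))))"

definition solves_min_max_multiway_cut :: "com \<Rightarrow> (nat \<Rightarrow> nat \<Rightarrow> nat \<Rightarrow> real) \<Rightarrow> bool" where
  "solves_min_max_multiway_cut c B \<longleftrightarrow>
     (\<forall>(G :: (nat, nat) mgraph) l r X s.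
        mmc_instance G r X \<and> enc_mmc G l r X s \<longrightarrow>
        (\<exists>k s'. exec c s k s' \<and> mmc_correct G l r X s' \<and> real k \<le> B (card (verts G)) l r))"

end

theory Submission
  imports Defs "HOL-Library.Countable" "HOL-Library.FuncSet"
begin

text \<open>
  Guess the numbers of edges between the classes of a multiway cut and ask the list allocation solver
  whether they can be realised when the \<open>i\<close>-th terminal is only allowed in class \<open>i\<close>. The
  guesses are enumerated as the digit vectors with digits at most \<open>l\<close> and digit sum at most \<open>r * l\<close>,
  in lexicographic order. Bounding the digits gives \<open>2 ^ O(r\<^sup>2 log l)\<close> guesses, bounding the digit sum
  gives \<open>2 ^ O(r l log r)\<close>.

  Since \<open>T\<close> is arbitrary, two further points matter. It need not be monotone, so each instance is
  brought to weight exactly \<open>r * l\<close> by parallel edges between two terminals. And the work around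
  the solver, which is of order \<open>n\<^sup>2\<close> per guess, has to be paid by \<open>T\<close>: in an edgeless graph whose
  vertices have pairwise distinct singleton lists, any additional edge destroys solvability, so
  the solver must inspect all pairs of vertices, and \<open>T n w\<close> is at least \<open>n (n - 1) / 2\<close>.
\<close>

section \<open>Executions\<close>

text \<open>The bounds on digits and digit sum do not limit the boundary of a single class, so every
  guess is also tested for row sums at most \<open>l\<close>, and only guesses that pass reach the
  solver. The test does double duty: it turns a solver answer into a multiway cut, and it keeps the
  weight at most \<open>r * l\<close>, so that the padding is a true difference and not a truncated
  one.

  Padding needs two terminals, so instances with \<open>r < 2\<close> are answered without the
  solver. The tables of about \<open>n * r + r * r\<close> cells stay within order
  \<open>n * n\<close>, because terminals are vertices and hence \<open>r \<le> n\<close>.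

  The solver may overwrite its input and all memory that it mentions. The search therefore keeps its
  state under names that the solver never assigns, and rewrites the whole instance before each call.
  The machine has no multiplication, which is why table positions are followed by running sums.

  One enumeration obeys both counting bounds at once, so the program never asks which term of the
  minimum is smaller.\<close>

lemma exec_pos: "exec c s k s' \<Longrightarrow> 1 \<le> k"
  by (induction rule: exec.induct) auto

fun assigned_regs :: "com \<Rightarrow> vname set" where
  "assigned_regs (Const x c) = {x}"
| "assigned_regs (Add x y z) = {x}"
| "assigned_regs (Sub x y z) = {x}"
| "assigned_regs (Load x a y) = {x}"
| "assigned_regs (Seq c1 c2) = assigned_regs c1 \<union> assigned_regs c2"
| "assigned_regs (IfNZ x c1 c2) = assigned_regs c1 \<union> assigned_regs c2"
| "assigned_regs (WhileNZ x c) = assigned_regs c"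
| "assigned_regs _ = {}"

fun assigned_arrs :: "com \<Rightarrow> vname set" where
  "assigned_arrs (Store a x y) = {a}"
| "assigned_arrs (Seq c1 c2) = assigned_arrs c1 \<union> assigned_arrs c2"
| "assigned_arrs (IfNZ x c1 c2) = assigned_arrs c1 \<union> assigned_arrs c2"
| "assigned_arrs (WhileNZ x c) = assigned_arrs c"
| "assigned_arrs _ = {}"

lemma finite_assigned: "finite (assigned_regs c)" "finite (assigned_arrs c)"
  by (induction c) auto

lemma exec_unassigned_reg: "exec c s k s' \<Longrightarrow> x \<notin> assigned_regs c \<Longrightarrow> regs s' x = regs s x"
  by (induction rule: exec.induct) auto

lemma exec_unassigned_arr: "exec c s k s' \<Longrightarrow> a \<notin> assigned_arrs c \<Longrightarrow> arrs s' a = arrs s a"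
  by (induction rule: exec.induct) auto

definition agree_on :: "vname \<Rightarrow> nat set \<Rightarrow> state \<Rightarrow> state \<Rightarrow> bool" where
  "agree_on a D s t \<longleftrightarrow> regs s = regs t \<and> (\<forall>b. b \<noteq> a \<longrightarrow> arrs s b = arrs t b) \<and>
     (\<forall>p\<in>D. arrs s a p = arrs t a p)"

text \<open>\<open>R\<close> collects the cells of \<open>a\<close> that the run reads; each step
  reads at most one. Since the registers coincide, both runs use the same addresses and take the
  same branches. Quantifying over all supersets \<open>D\<close> of \<open>R\<close> makes the
  induction compose: the first half of a sequence must preserve agreement also on cells that only
  the second half reads.\<close>

lemma exec_inspects:
  "exec c s k s' \<Longrightarrow> \<exists>R. finite R \<and> card R \<le> k \<and>
     (\<forall>D t. R \<subseteq> D \<longrightarrow> agree_on a D s t \<longrightarrow> (\<exists>t'. exec c t k t' \<and> agree_on a D s' t'))"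
proof (induction rule: exec.induct)
  case (Skip s)
  show ?case
    by (intro exI[of _ "{}"] conjI allI impI, simp, simp, rule exI, rule conjI, rule exec.Skip)
      (auto simp: agree_on_def)
next
  case (Const x c s)
  show ?case
    by (intro exI[of _ "{}"] conjI allI impI, simp, simp, rule exI, rule conjI, rule exec.Const)
      (auto simp: agree_on_def)
next
  case (Add x y z s)
  show ?case
    by (intro exI[of _ "{}"] conjI allI impI, simp, simp, rule exI, rule conjI, rule exec.Add)
      (auto simp: agree_on_def)
next
  case (Sub x y z s)
  show ?case
    by (intro exI[of _ "{}"] conjI allI impI, simp, simp, rule exI, rule conjI, rule exec.Sub)
      (auto simp: agree_on_def)
next
  case (Load x b y s)
  have "agree_on a D (s\<lparr>regs := (regs s)(x := arrs s b (regs s y))\<rparr>)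
      (t\<lparr>regs := (regs t)(x := arrs t b (regs t y))\<rparr>)"
    if "agree_on a D s t" "regs s y \<in> D" for D t
    using that by (cases "b = a") (auto simp: agree_on_def)
  then show ?case
    by (intro exI[of _ "{regs s y}"] conjI allI impI, simp, simp)
      (rule exI, rule conjI, rule exec.Load, simp)
next
  case (Store b x y s)
  show ?case
    by (intro exI[of _ "{}"] conjI allI impI, simp, simp, rule exI, rule conjI, rule exec.Store)
      (auto simp: agree_on_def)
next
  case (Seq c1 s k1 s' c2 k2 s'')
  then obtain R1 R2 where
    R: "finite R1" "card R1 \<le> k1" "finite R2" "card R2 \<le> k2"
    and 1: "\<And>D t. R1 \<subseteq> D \<Longrightarrow> agree_on a D s t \<Longrightarrow> \<exists>t'. exec c1 t k1 t' \<and> agree_on a D s' t'"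
    and 2: "\<And>D t. R2 \<subseteq> D \<Longrightarrow> agree_on a D s' t \<Longrightarrow> \<exists>t'. exec c2 t k2 t' \<and> agree_on a D s'' t'"
    by blast
  have "card (R1 \<union> R2) \<le> k1 + k2"
    using card_Un_le[of R1 R2] R by linarith
  then show ?case
    using R 1 2 by (intro exI[of _ "R1 \<union> R2"]) (simp, meson exec.Seq)
next
  case (IfTrue s x c1 k s' c2)
  then obtain R where R: "finite R" "card R \<le> k"
    "\<And>D t. R \<subseteq> D \<Longrightarrow> agree_on a D s t \<Longrightarrow> \<exists>t'. exec c1 t k t' \<and> agree_on a D s' t'"
    by blast
  have "exec (IfNZ x c1 c2) t (1 + k) t'" if "agree_on a D s t" "exec c1 t k t'" for D t t'
    using that IfTrue.hyps by (intro exec.IfTrue) (auto simp: agree_on_def)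
  then show ?case
    using R by (intro exI[of _ R]) (auto, metis)
next
  case (IfFalse s x c2 k s' c1)
  then obtain R where R: "finite R" "card R \<le> k"
    "\<And>D t. R \<subseteq> D \<Longrightarrow> agree_on a D s t \<Longrightarrow> \<exists>t'. exec c2 t k t' \<and> agree_on a D s' t'"
    by blast
  have "exec (IfNZ x c1 c2) t (1 + k) t'" if "agree_on a D s t" "exec c2 t k t'" for D t t'
    using that IfFalse.hyps by (intro exec.IfFalse) (auto simp: agree_on_def)
  then show ?case
    using R by (intro exI[of _ R]) (auto, metis)
next
  case (WhileTrue s x c k1 s' k2 s'')
  then obtain R1 R2 where
    R: "finite R1" "card R1 \<le> k1" "finite R2" "card R2 \<le> k2"
    and 1: "\<And>D t. R1 \<subseteq> D \<Longrightarrow> agree_on a D s t \<Longrightarrow> \<exists>t'. exec c t k1 t' \<and> agree_on a D s' t'"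
    and 2: "\<And>D t. R2 \<subseteq> D \<Longrightarrow> agree_on a D s' t \<Longrightarrow>
      \<exists>t'. exec (WhileNZ x c) t k2 t' \<and> agree_on a D s'' t'"
    by blast
  have "card (R1 \<union> R2) \<le> 1 + k1 + k2"
    using card_Un_le[of R1 R2] R by linarith
  moreover have "\<exists>t'. exec (WhileNZ x c) t (1 + k1 + k2) t' \<and> agree_on a D s'' t'"
    if "R1 \<union> R2 \<subseteq> D" and a: "agree_on a D s t" for D t
  proof -
    have "regs t x \<noteq> 0"
      using a WhileTrue.hyps by (auto simp: agree_on_def)
    then show ?thesis
      using that 1[of D t] 2[of D] by (meson Un_subset_iff exec.WhileTrue)
  qed
  ultimately show ?case
    using R by (intro exI[of _ "R1 \<union> R2"]) simp
next
  case (WhileFalse s x c)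
  show ?case
    using WhileFalse
    by (intro exI[of _ "{}"] conjI allI impI, simp, simp)
      (rule exI, rule conjI, rule exec.WhileFalse, auto simp: agree_on_def)
qed

section \<open>Adding parallel edges\<close>

text \<open>Edges are natural numbers, so fresh ones are the \<open>m\<close> numbers from
  \<open>b\<close> on, where \<open>b\<close> exceeds every existing edge. The inserted
  \<open>0\<close> keeps \<open>Max\<close> defined for an edgeless graph.\<close>

definition add_edges :: "('v, nat) mgraph \<Rightarrow> nat \<Rightarrow> 'v \<Rightarrow> 'v \<Rightarrow> ('v, nat) mgraph" where
  "add_edges G m u v = (let b = Suc (Max (insert 0 (edges G))) in
     G\<lparr>edges := edges G \<union> {b..<b + m}, ends := (\<lambda>e. if e < b then ends G e else {u, v})\<rparr>)"

lemma add_edges_verts [simp]: "verts (add_edges G m u v) = verts G"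
  by (simp add: add_edges_def Let_def)

lemma edges_below: "finite (E :: nat set) \<Longrightarrow> e \<in> E \<Longrightarrow> e < Suc (Max (insert 0 E))"
  by (simp add: less_Suc_eq_le)

lemma wf_add_edges:
  assumes "wf_mgraph G" "u \<in> verts G" "v \<in> verts G" "u \<noteq> v"
  shows "wf_mgraph (add_edges G m u v)"
proof -
  define b where "b = Suc (Max (insert 0 (edges G)))"
  have "e \<in> edges G \<Longrightarrow> e < b" for e
    using assms edges_below[of "edges G"] by (auto simp: wf_mgraph_def b_def)
  then show ?thesis
    using assms unfolding wf_mgraph_def add_edges_def Let_def b_def[symmetric] by auto
qed

lemma delta_add_edges:
  assumes "wf_mgraph G"
  shows "card (delta (add_edges G m u v) A B) =
    card (delta G A B) + (if u \<in> A \<and> v \<in> B \<or> v \<in> A \<and> u \<in> B then m else 0)"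
proof -
  define b where "b = Suc (Max (insert 0 (edges G)))"
  have fin: "finite (edges G)" and lt: "e \<in> edges G \<Longrightarrow> e < b" for e
    using assms edges_below[of "edges G"] by (auto simp: wf_mgraph_def b_def)
  have "delta (add_edges G m u v) A B =
      delta G A B \<union> (if u \<in> A \<and> v \<in> B \<or> v \<in> A \<and> u \<in> B then {b..<b + m} else {})"
    (is "_ = ?D")
  proof (intro equalityI subsetI)
    fix e
    assume "e \<in> delta (add_edges G m u v) A B"
    then show "e \<in> ?D"
      using lt[of e] unfolding delta_def add_edges_def Let_def b_def[symmetric]
      by (auto simp: doubleton_eq_iff split: if_splits)
  next
    fix e
    assume "e \<in> ?D"
    then show "e \<in> delta (add_edges G m u v) A B"
      using lt[of e] unfolding delta_def add_edges_def Let_def b_def[symmetric]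
      by (auto simp: doubleton_eq_iff split: if_splits)
  qed
  moreover have "delta G A B \<inter> {b..<b + m} = {}" "finite (delta G A B)"
    using lt fin by (force simp: delta_def)+
  ultimately show ?thesis by (simp add: card_Un_disjoint)
qed

lemma delta_commute: "delta G A B = delta G B A"
  by (auto simp: delta_def insert_commute)

section \<open>Any solver inspects the whole graph\<close>

lemma row_major_inj:
  fixes u v u' v' n :: nat
  assumes "v < n" "v' < n"
  shows "u * n + v = u' * n + v' \<longleftrightarrow> u = u' \<and> v = v'"
proof -
  have "(u * n + v) div n = u" "(u' * n + v') div n = u'"
    "(u * n + v) mod n = v" "(u' * n + v') mod n = v'"
    using assms by auto
  then show ?thesis by metis
qed

lemma row_major_inj_labels:
  fixes u i u' i' r :: nat
  assumes "i \<in> {1..r}" "i' \<in> {1..r}"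
  shows "u * r + i = u' * r + i' \<longleftrightarrow> u = u' \<and> i = i'"
  using assms row_major_inj[of "i - 1" r "i' - 1" u u'] by auto

lemma row_major_less: "u < a \<Longrightarrow> v < n \<Longrightarrow> u * n + v < a * (n :: nat)"
  using mult_le_mono1[of "Suc u" a n] by simp

text \<open>The time bound of a solver is available only for actual memory states, so the instances
  of the lower bound have to be encoded. Labels start at 1, hence the label tables are decoded from
  \<open>p - 1\<close> and the remainder is shifted back.\<close>

lemma exists_enc_la:
  fixes G :: "(nat, 'e) mgraph"
  assumes "verts G = {..<n}"
  shows "\<exists>s. enc_la G r lam \<alpha> s"
proof -
  define s where "s = \<lparr>regs = (\<lambda>_. 0)(''n'' := n, ''r'' := r),
    arrs = (\<lambda>_ _. 0)(''G'' := \<lambda>p. card (delta G {p div n} {p mod n}),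
      ''lambda'' := \<lambda>p. if (p - 1) mod r + 1 \<in> lam ((p - 1) div r) then 1 else 0,
      ''alpha'' := \<lambda>p. \<alpha> {(p - 1) div r, (p - 1) mod r + 1})\<rparr>"
  have *: "(v * r + i - Suc 0) div r = v" "Suc ((v * r + i - Suc 0) mod r) = i"
    if "i \<in> {1..r}" for v i
  proof -
    define j where "j = i - 1"
    have "i = Suc j" "j < r"
      using that by (auto simp: j_def)
    then show "(v * r + i - Suc 0) div r = v" "Suc ((v * r + i - Suc 0) mod r) = i" by auto
  qed
  have "(u * n + v) div n = u" "(u * n + v) mod n = v" if "v < n" for u v
    using that by auto
  then have "enc_la G r lam \<alpha> s"
    using assms * by (auto simp: enc_la_def enc_graph_def s_def)
  then show ?thesis ..
qed

text \<open>Serves the padding and, with \<open>f\<close> constantly zero, the lower-bound instances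
  of prescribed weight. With fewer than two labels \<open>{1, 2}\<close> would not be a pair of
  labels, and the extra value would not count.\<close>

lemma la_weight_pair:
  assumes "2 \<le> r"
  shows "la_weight r (\<lambda>p. f p + (if p = {1, 2} then d else 0)) = la_weight r f + d"
proof -
  let ?P = "{p. p \<subseteq> {1..r} \<and> card p = 2}"
  have "finite ?P" by (rule finite_subset[of _ "Pow {1..r}"]) auto
  moreover have "{1, 2} \<in> ?P" using assms by auto
  ultimately show ?thesis by (simp add: la_weight_def sum.distrib sum.delta)
qed

lemma solves_list_allocationE:
  fixes G :: "(nat, nat) mgraph"
  assumes "solves_list_allocation P T" "la_instance G r lam" "enc_la G r lam \<alpha> s"
  obtains k s' where "exec P s k s'" "la_correct G r lam \<alpha> s'"
    "r \<le> card (verts G) + 1 \<longrightarrow> real k \<le> T (card (verts G)) (la_weight r \<alpha>)"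
  using assms unfolding solves_list_allocation_def by blast

text \<open>An adversary argument with \<open>n\<close> labels, few enough for the time bound to
  apply. To reach weight \<open>w\<close>, the otherwise edgeless graph carries \<open>w\<close>
  edges between the vertices 0 and 1. The lists leave only the allocation into singletons. If a run
  read neither of the two cells of some pair, one more edge there would be invisible to it, and it
  would accept an instance whose cut size no longer fits \<open>\<alpha>\<close>. So every pair of
  vertices accounts for a read of its own.\<close>

lemma lower_bound_pairs:
  assumes P: "solves_list_allocation P T" and n: "2 \<le> n"
  shows "real (n * (n - 1) div 2) \<le> T n w"
proof -
  define E :: "(nat, nat) mgraph" where "E = \<lparr>verts = {..<n}, edges = {}, ends = (\<lambda>_. {})\<rparr>"
  define G where "G = add_edges E w 0 1"
  define lam where "lam = (\<lambda>v::nat. {Suc v})"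
  \<comment> \<open>The summand \<open>0\<close> gives \<open>\<alpha>\<close> the shape of
    \<open>la_weight_pair\<close> with \<open>f\<close> constantly zero.\<close>
  define \<alpha> where "\<alpha> = (\<lambda>p :: nat set. 0 + (if p = {1, 2} then w else 0))"
  have E: "wf_mgraph E" "verts E = {..<n}" "delta E A B = {}" for A B
    by (auto simp: E_def wf_mgraph_def delta_def)
  have G: "wf_mgraph G" "verts G = {..<n}"
    unfolding G_def using n by (auto intro!: wf_add_edges simp: E)
  have delta_G: "card (delta G A B) = (if 0 \<in> A \<and> 1 \<in> B \<or> 1 \<in> A \<and> 0 \<in> B then w else 0)" for A B
    unfolding G_def by (simp add: delta_add_edges E)
  have weight: "la_weight n \<alpha> = w"
    unfolding \<alpha>_def la_weight_pair[OF n] by (simp add: la_weight_def)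
  have inst: "la_instance H n lam" if "wf_mgraph H" "verts H = {..<n}" for H :: "(nat, nat) mgraph"
    using that n by (auto simp: la_instance_def lam_def)
  have sol: "la_solution G n lam \<alpha> (\<lambda>i. {i - 1})"
  proof -
    have "x \<in> (\<Union>i\<in>{1..n}. {i - 1})" if "x < n" for x
      by (rule UN_I[of "Suc x"]) (use that in auto)
    then have "(\<Union>i\<in>{1..n}. {i - 1}) = {..<n}" by fastforce
    moreover have "disjoint_family_on (\<lambda>i. {i - 1}) {1..n}"
      by (auto simp: disjoint_family_on_def)
    ultimately have "allocation n (verts G) (\<lambda>i. {i - 1})"
      by (simp add: allocation_def G)
    moreover have "card (delta G {i - 1} {j - 1}) = \<alpha> {i, j}" if "i \<in> {1..n}" "j \<in> {1..n}" for i j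
      using that by (auto simp: delta_G \<alpha>_def doubleton_eq_iff)
    ultimately show ?thesis
      by (simp add: la_solution_def lam_def)
  qed
  obtain s where s: "enc_la G n lam \<alpha> s"
    using exists_enc_la[OF G(2)] by blast
  obtain k s' where k: "exec P s k s'" "la_correct G n lam \<alpha> s'"
    "n \<le> card (verts G) + 1 \<longrightarrow> real k \<le> T (card (verts G)) (la_weight n \<alpha>)"
    by (rule solves_list_allocationE[OF P inst[OF G] s])
  have k_le: "real k \<le> T n w"
    using k(3) by (simp add: weight G)
  have sol': "regs s' ''ans'' = 1" "la_solution G n lam \<alpha> (out_class G s')"
    using k(2) sol unfolding la_correct_def by blast+
  obtain R where R: "finite R" "card R \<le> k"
    and R': "\<forall>D t. R \<subseteq> D \<longrightarrow> agree_on ''G'' D s t \<longrightarrow>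
      (\<exists>t'. exec P t k t' \<and> agree_on ''G'' D s' t')"
    using exec_inspects[OF k(1), of "''G''"] by (elim exE conjE)
  have read: "u * n + v \<in> R \<or> v * n + u \<in> R" if uv: "u < v" "v < n" for u v
  proof (rule ccontr)
    assume notR: "\<not> (u * n + v \<in> R \<or> v * n + u \<in> R)"
    define H where "H = add_edges G 1 u v"
    \<comment> \<open>Both symmetric cells are raised, since the matrix records an edge under
      \<open>(u, v)\<close> and under \<open>(v, u)\<close>.\<close>
    define t where "t = s\<lparr>arrs := (arrs s)(''G'' := \<lambda>p. arrs s ''G'' p +
      (if p = u * n + v \<or> p = v * n + u then 1 else 0))\<rparr>"
    have H: "wf_mgraph H" "verts H = {..<n}"
      unfolding H_def using uv by (auto intro!: wf_add_edges simp: G)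
    have delta_H: "card (delta H A B) =
        card (delta G A B) + (if u \<in> A \<and> v \<in> B \<or> v \<in> A \<and> u \<in> B then 1 else 0)" for A B
      unfolding H_def by (rule delta_add_edges[OF G(1)])
    have "enc_la H n lam \<alpha> t"
      using s uv unfolding enc_la_def enc_graph_def
      by (auto simp: t_def H G delta_H row_major_inj Let_def)
    then obtain k2 t2 where t2: "exec P t k2 t2" "la_correct H n lam \<alpha> t2"
      by (rule solves_list_allocationE[OF P inst[OF H]])
    have "agree_on ''G'' R s t"
      using notR by (auto simp: agree_on_def t_def)
    then obtain t' where t': "exec P t k t'" "agree_on ''G'' R s' t'"
      using R' by blast
    then have "agree_on ''G'' R s' t2"
      using exec_deterministic[OF t2(1) t'(1)] by simp
    then have "regs t2 ''ans'' = 1" "out_class H t2 = out_class G s'"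
      using sol' by (auto simp: agree_on_def out_class_def H G)
    then have solH: "la_solution H n lam \<alpha> (out_class G s')"
      using t2(2) unfolding la_correct_def by simp
    obtain i j where ij: "i \<in> {1..n}" "j \<in> {1..n}" "u \<in> out_class G s' i" "v \<in> out_class G s' j"
    proof -
      have "(\<Union>i\<in>{1..n}. out_class G s' i) = {..<n}"
        using solH H by (simp add: la_solution_def allocation_def)
      then have "u \<in> (\<Union>i\<in>{1..n}. out_class G s' i)" "v \<in> (\<Union>i\<in>{1..n}. out_class G s' i)"
        using uv by auto
      then show ?thesis using that by blast
    qed
    moreover have "i \<noteq> j"
    proof -
      have "i \<in> lam u" "j \<in> lam v"
        using solH ij unfolding la_solution_def by blast+
      then show ?thesis using uv by (simp add: lam_def)
    qed
    ultimately have "card (delta H (out_class G s' i) (out_class G s' j)) = \<alpha> {i, j}"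
      "card (delta G (out_class G s' i) (out_class G s' j)) = \<alpha> {i, j}"
      using solH sol'(2) unfolding la_solution_def by blast+
    then show False using ij by (simp add: delta_H)
  qed
  \<comment> \<open>Picks for each pair one of its two cells that was read. Distinct pairs have
    disjoint cells, so this injects the pairs into \<open>R\<close>.\<close>
  define c where "c = (\<lambda>(u, v). if u * n + v \<in> R then u * n + v else v * n + u)"
  define Q where "Q = (SIGMA v:{..<n}. {..<v})"
  have "inj_on (\<lambda>(v, u). c (u, v)) Q"
    by (rule inj_onI) (auto simp: Q_def c_def row_major_inj split: if_splits)
  moreover have "(\<lambda>(v, u). c (u, v)) ` Q \<subseteq> R"
    using read by (fastforce simp: Q_def c_def)
  ultimately have "card Q \<le> card R"
    using R(1) by (metis card_image card_mono)
  moreover have "card Q = n * (n - 1) div 2"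
    by (simp add: Q_def Sum_Ico_nat lessThan_atLeast0)
  ultimately show ?thesis using R(2) k_le by linarith
qed

text \<open>For \<open>n < 2\<close> the quadratic bound is vacuous, and the fact that every run
  takes at least one step replaces it. \<open>r = n + 1\<close> is the largest number of labels for
  which the time bound is promised: for \<open>n = 1\<close> two labels realise any weight, but for
  \<open>n = 0\<close> a single label remains and the weight is 0.\<close>

lemma lower_bound_one:
  assumes P: "solves_list_allocation P T" and n: "n = 1 \<or> n = 0 \<and> w = 0"
  shows "1 \<le> T n w"
proof -
  define E :: "(nat, nat) mgraph" where "E = \<lparr>verts = {..<n}, edges = {}, ends = (\<lambda>_. {})\<rparr>"
  define \<alpha> where "\<alpha> = (\<lambda>p :: nat set. 0 + (if p = {1, 2} then w else 0))"
  define r where "r = Suc n"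
  have "p \<subseteq> {Suc 0} \<Longrightarrow> card p \<noteq> 2" for p
    using card_mono[of "{Suc 0}" p] by auto
  then have "la_weight (Suc 0) \<alpha> = 0"
    by (auto simp: la_weight_def)
  moreover have "la_weight 2 \<alpha> = w"
    unfolding \<alpha>_def la_weight_pair[OF order.refl] by (simp add: la_weight_def)
  ultimately have w: "la_weight r \<alpha> = w"
    using n by (auto simp: r_def numeral_2_eq_2)
  have E: "la_instance E r (\<lambda>_. {})" "verts E = {..<n}"
    by (auto simp: E_def la_instance_def wf_mgraph_def r_def)
  obtain s where s: "enc_la E r (\<lambda>_. {}) \<alpha> s"
    using exists_enc_la[OF E(2)] by blast
  obtain k s' where k: "exec P s k s'" "la_correct E r (\<lambda>_. {}) \<alpha> s'"
    "r \<le> card (verts E) + 1 \<longrightarrow> real k \<le> T (card (verts E)) (la_weight r \<alpha>)"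
    by (rule solves_list_allocationE[OF P E(1) s])
  have "real k \<le> T n w"
    using k(3) by (simp add: w E(2)) (simp add: r_def)
  then show ?thesis using exec_pos[OF k(1)] by simp
qed

text \<open>The factor 4 comes from \<open>n * n \<le> 2 * (n * (n - 1))\<close> for
  \<open>n \<ge> 2\<close>.\<close>

lemma lower_bound:
  assumes "solves_list_allocation P T" "1 \<le> n"
  shows "1 \<le> T n w" "real (n * n) \<le> 4 * T n w"
proof -
  have "1 \<le> T n w \<and> real (n * n) \<le> 4 * T n w"
  proof (cases "n = 1")
    case True
    then show ?thesis using lower_bound_one[OF assms(1), of n w] by simp
  next
    case False
    then have n: "2 \<le> n" using assms by simp
    have "even (n * (n - 1))" using n by (cases "even n") auto
    then have "2 * (n * (n - 1) div 2) = n * (n - 1)" by simp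
    moreover have "n * n \<le> n * (2 * (n - 1))"
      using n by (intro mult_le_mono2) simp
    moreover have "2 * 1 \<le> n * (n - 1)"
      using n by (intro mult_le_mono) auto
    ultimately have "n * n \<le> 4 * (n * (n - 1) div 2)" "1 \<le> n * (n - 1) div 2" by linarith+
    then show ?thesis using lower_bound_pairs[OF assms(1) n, of w] by linarith
  qed
  then show "1 \<le> T n w" "real (n * n) \<le> 4 * T n w" by auto
qed

section \<open>Multiway cuts as allocations\<close>

text \<open>A labelled multiway cut, with the boundary of a class split up by the class at the other
  end. In this form it can be compared with prescribed cut sizes.\<close>

definition multiway_allocation ::
    "('v, 'e) mgraph \<Rightarrow> nat \<Rightarrow> nat \<Rightarrow> ('v \<Rightarrow> nat set) \<Rightarrow> (nat \<Rightarrow> 'v set) \<Rightarrow> bool" where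
  "multiway_allocation G l r lam \<V> \<longleftrightarrow> allocation r (verts G) \<V> \<and>
     (\<forall>i\<in>{1..r}. \<forall>v\<in>\<V> i. i \<in> lam v) \<and>
     (\<forall>i\<in>{1..r}. (\<Sum>j\<in>{1..r} - {i}. card (delta G (\<V> i) (\<V> j))) \<le> l)"

text \<open>As the classes partition the vertices, an edge leaving class \<open>i\<close> ends in
  exactly one other class. So the sets counted on the right are disjoint and cover the
  boundary.\<close>

lemma card_boundary:
  assumes wf: "wf_mgraph G" and alloc: "allocation r (verts G) \<V>" and i: "i \<in> {1..r}"
  shows "card {e \<in> edges G. card (ends G e \<inter> \<V> i) = 1} =
    (\<Sum>j\<in>{1..r} - {i}. card (delta G (\<V> i) (\<V> j)))"
proof -
  have fin: "finite (edges G)" using wf by (simp add: wf_mgraph_def)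
  have disj: "a = b" if "a \<in> {1..r}" "b \<in> {1..r}" "x \<in> \<V> a" "x \<in> \<V> b" for a b x
    using alloc that unfolding allocation_def disjoint_family_on_def by blast
  have cover: "\<exists>j\<in>{1..r}. x \<in> \<V> j" if "x \<in> verts G" for x
    using alloc that unfolding allocation_def by blast
  have "{e \<in> edges G. card (ends G e \<inter> \<V> i) = 1} = (\<Union>j\<in>{1..r} - {i}. delta G (\<V> i) (\<V> j))"
    (is "?L = ?R")
  proof (intro equalityI subsetI)
    fix e assume e: "e \<in> ?L"
    then have "card (ends G e) = 2" "ends G e \<subseteq> verts G" "card (ends G e \<inter> \<V> i) = 1"
      using wf by (auto simp: wf_mgraph_def)
    then obtain x y where xy: "ends G e = {x, y}" "x \<noteq> y" "x \<in> verts G" "y \<in> verts G"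
      by (auto simp: card_2_iff)
    have "\<exists>x y. ends G e = {x, y} \<and> x \<in> \<V> i \<and> y \<notin> \<V> i \<and> y \<in> verts G"
    proof (cases "x \<in> \<V> i")
      case True
      then have "y \<notin> \<V> i" using xy e by auto
      then show ?thesis using True xy by blast
    next
      case False
      then have "ends G e \<inter> \<V> i = {}" if "y \<notin> \<V> i" using xy that by auto
      then have "y \<in> \<V> i" using e by force
      then show ?thesis using False xy by (metis insert_commute)
    qed
    then obtain x y where "ends G e = {x, y}" "x \<in> \<V> i" "y \<notin> \<V> i" "y \<in> verts G"
      by blast
    then show "e \<in> ?R"
      using cover[of y] e unfolding delta_def by blast
  next
    fix e assume "e \<in> ?R"
    then obtain j x y where j: "j \<in> {1..r}" "j \<noteq> i" "e \<in> edges G" "x \<in> \<V> i" "y \<in> \<V> j"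
      "ends G e = {x, y}"
      unfolding delta_def by blast
    then have "y \<notin> \<V> i" using disj[of j i y] i by auto
    then have "ends G e \<inter> \<V> i = {x}" using j by auto
    then have "card (ends G e \<inter> \<V> i) = 1" by simp
    then show "e \<in> ?L" using j(3) by blast
  qed
  moreover have "delta G (\<V> i) (\<V> j) \<inter> delta G (\<V> i) (\<V> k) = {}"
    if "j \<in> {1..r} - {i}" "k \<in> {1..r} - {i}" "j \<noteq> k" for j k
  proof (rule ccontr)
    assume "\<not> ?thesis"
    then obtain e x y x' z where "x \<in> \<V> i" "x' \<in> \<V> i" "y \<in> \<V> j" "z \<in> \<V> k"
      "ends G e = {x, y}" "ends G e = {x', z}"
      unfolding delta_def by blast
    then have "y = z \<or> y = x'"
      by (auto simp: doubleton_eq_iff)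
    then show False
      using disj[of j k y] disj[of j i y] that i \<open>x' \<in> \<V> i\<close> \<open>y \<in> \<V> j\<close> \<open>z \<in> \<V> k\<close> by auto
  qed
  moreover have "finite (delta G A B)" for A B
    using fin by (simp add: delta_def)
  ultimately show ?thesis by (simp add: card_UN_disjoint)
qed

locale numbered_terminals =
  fixes G :: "('v, 'e) mgraph" and r :: nat and X :: "'v set" and num :: "'v \<Rightarrow> nat"
  assumes inst: "mmc_instance G r X" and num: "bij_betw num X {1..r}"
begin

definition lists :: "'v \<Rightarrow> nat set" where
  "lists v = (if v \<in> X then {num v} else {1..r})"

lemma allocation_terminal:
  assumes "allocation r (verts G) \<V>" "\<forall>i\<in>{1..r}. \<forall>v\<in>\<V> i. i \<in> lists v"
    and "t \<in> X" "i \<in> {1..r}"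
  shows "t \<in> \<V> i \<longleftrightarrow> num t = i"
proof -
  have "t \<in> verts G" using assms(3) inst by (auto simp: mmc_instance_def)
  then obtain j where "j \<in> {1..r}" "t \<in> \<V> j"
    using assms(1) unfolding allocation_def by blast
  then show ?thesis
    using assms(2-4) unfolding lists_def by (metis singletonD)
qed

text \<open>Every class contains its own terminal and no other. This gives the terminal condition,
  and it also makes the classes nonempty and distinct, which an allocation alone does not
  promise.\<close>

lemma solution_of_allocation:
  assumes "multiway_allocation G l r lists \<V>"
  shows "mmc_solution G l r X (\<V> ` {1..r})"
proof -
  have wf: "wf_mgraph G" using inst by (simp add: mmc_instance_def)
  have alloc: "allocation r (verts G) \<V>" and ls: "\<forall>i\<in>{1..r}. \<forall>v\<in>\<V> i. i \<in> lists v"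
    using assms by (auto simp: multiway_allocation_def)
  have disj: "a = b" if "a \<in> {1..r}" "b \<in> {1..r}" "x \<in> \<V> a" "x \<in> \<V> b" for a b x
    using alloc that unfolding allocation_def disjoint_family_on_def by blast
  have ex: "\<exists>t. \<V> i \<inter> X = {t}" if i: "i \<in> {1..r}" for i
  proof -
    obtain t where t: "t \<in> X" "num t = i"
      using num i unfolding bij_betw_def by (metis imageE)
    have "\<V> i \<inter> X = {t}"
    proof (intro equalityI subsetI)
      fix x assume "x \<in> \<V> i \<inter> X"
      then have "x \<in> X" "num x = num t"
        using allocation_terminal[OF alloc ls, of x i] i t by auto
      then show "x \<in> {t}"
        using t num by (auto simp: bij_betw_def dest: inj_onD)
    qed (use t allocation_terminal[OF alloc ls, of t i] i in auto)
    then show ?thesis ..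
  qed
  have inj: "inj_on \<V> {1..r}"
  proof (rule inj_onI)
    fix a b assume ab: "a \<in> {1..r}" "b \<in> {1..r}" "\<V> a = \<V> b"
    then obtain t where "t \<in> \<V> a" using ex[of a] by blast
    then show "a = b" using disj[of a b t] ab by simp
  qed
  have "partition_on (verts G) (\<V> ` {1..r})"
    unfolding partition_on_def disjoint_def
  proof (intro conjI ballI impI)
    show "\<Union> (\<V> ` {1..r}) = verts G" using alloc by (simp add: allocation_def)
    show "{} \<notin> \<V> ` {1..r}" using ex by fastforce
    show "p \<inter> q = {}" if "p \<in> \<V> ` {1..r}" "q \<in> \<V> ` {1..r}" "p \<noteq> q" for p q
      using that disj by blast
  qed
  moreover have "card (\<V> ` {1..r}) = r" using inj by (simp add: card_image)
  moreover have "card (\<V> i \<inter> X) = 1" if "i \<in> {1..r}" for i using ex[OF that] by auto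
  moreover have "card {e \<in> edges G. card (ends G e \<inter> \<V> i) = 1} \<le> l" if "i \<in> {1..r}" for i
    using card_boundary[OF wf alloc that] assms that by (simp add: multiway_allocation_def)
  ultimately show ?thesis unfolding mmc_solution_def by blast
qed

text \<open>Each block is labelled by the number of its only terminal; \<open>\<V>\<close> inverts
  this labelling.\<close>

lemma allocation_of_solution:
  assumes sol: "mmc_solution G l r X \<P>"
  shows "\<exists>\<V>. multiway_allocation G l r lists \<V>"
proof -
  have wf: "wf_mgraph G" and X: "X \<subseteq> verts G" "card X = r"
    using inst by (auto simp: mmc_instance_def)
  have part: "partition_on (verts G) \<P>" and c: "card \<P> = r"
    and one: "\<And>p. p \<in> \<P> \<Longrightarrow> card (p \<inter> X) = 1"
    and bd: "\<And>p. p \<in> \<P> \<Longrightarrow> card {e \<in> edges G. card (ends G e \<inter> p) = 1} \<le> l"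
    using sol by (auto simp: mmc_solution_def)
  have finP: "finite \<P>"
    using part wf finite_elements by (auto simp: wf_mgraph_def)
  define t where "t = (\<lambda>p. THE x. x \<in> p \<inter> X)"
  have t: "p \<inter> X = {t p}" if "p \<in> \<P>" for p
  proof -
    have "\<exists>x. p \<inter> X = {x}" using one[OF that] by (auto simp: card_1_singleton_iff)
    then show ?thesis by (auto simp: t_def simp del: Int_iff)
  qed
  have Pdisj: "p = q" if "p \<in> \<P>" "q \<in> \<P>" "x \<in> p" "x \<in> q" for p q x
    using part that unfolding partition_on_def disjoint_def by blast
  have injt: "inj_on t \<P>"
    by (rule inj_onI) (metis Pdisj t IntD1 insertI1)
  have "t ` \<P> \<subseteq> X" using t by blast
  moreover have "finite X" using X wf finite_subset by (auto simp: wf_mgraph_def)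
  \<comment> \<open>Injectivity and \<open>card \<P> = r = card X\<close> force every terminal to
    occur.\<close>
  ultimately have "t ` \<P> = X"
    using injt c X by (metis card_image card_subset_eq)
  then have bij: "bij_betw (num \<circ> t) \<P> {1..r}"
    using bij_betw_trans[of t \<P> X num] injt num by (simp add: bij_betw_def)
  define \<V> where "\<V> = inv_into \<P> (num \<circ> t)"
  have V: "\<V> i \<in> \<P>" "num (t (\<V> i)) = i" if "i \<in> {1..r}" for i
    using bij that unfolding \<V>_def bij_betw_def
    by (metis inv_into_into) (metis bij bij_betw_def comp_apply f_inv_into_f that)
  have "\<V> ` {1..r} = \<P>"
    using bij bij_betw_inv_into[OF bij] by (simp add: \<V>_def bij_betw_def)
  then have "(\<Union>i\<in>{1..r}. \<V> i) = verts G"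
    using part by (simp add: partition_on_def)
  moreover have "disjoint_family_on \<V> {1..r}"
    unfolding disjoint_family_on_def using V Pdisj by (metis disjoint_iff)
  ultimately have alloc: "allocation r (verts G) \<V>" by (simp add: allocation_def)
  moreover have "i \<in> lists v" if i: "i \<in> {1..r}" and v: "v \<in> \<V> i" for i v
  proof (cases "v \<in> X")
    case True
    then have "v = t (\<V> i)" using t[OF V(1)[OF i]] v by blast
    then show ?thesis using True V(2)[OF i] by (simp add: lists_def)
  qed (use i in \<open>simp add: lists_def\<close>)
  moreover have "(\<Sum>j\<in>{1..r} - {i}. card (delta G (\<V> i) (\<V> j))) \<le> l" if "i \<in> {1..r}" for i
    using card_boundary[OF wf alloc that] bd[OF V(1)[OF that]] by simp
  ultimately have "multiway_allocation G l r lists \<V>" by (simp add: multiway_allocation_def)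
  then show ?thesis by blast
qed

end

section \<open>Cut sizes as digit vectors\<close>

text \<open>A vector \<open>a\<close> of digits describes the cut sizes \<open>\<alpha> {i, j} = a (i * r + j)\<close> for \<open>i < j\<close>;
  the other digits are irrelevant.\<close>

definition cut_size :: "nat \<Rightarrow> (nat \<Rightarrow> nat) \<Rightarrow> nat set \<Rightarrow> nat" where
  "cut_size r a p = a (Min p * r + Max p)"

text \<open>The part of being a multiway cut that membership in \<open>digit_vectors\<close> does
  not enforce; it is decided for each guess separately.\<close>

definition row_ok :: "nat \<Rightarrow> nat \<Rightarrow> (nat \<Rightarrow> nat) \<Rightarrow> bool" where
  "row_ok r l a \<longleftrightarrow> (\<forall>i\<in>{1..r}. (\<Sum>j\<in>{1..r} - {i}. cut_size r a {i, j}) \<le> l)"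

lemma cut_size_pair: "i < j \<Longrightarrow> cut_size r a {i, j} = a (i * r + j)"
  by (simp add: cut_size_def min_def max_def)

lemma la_weight_eq: "la_weight r \<alpha> = (\<Sum>i\<in>{1..r}. \<Sum>j\<in>{i<..r}. \<alpha> {i, j})"
proof -
  let ?Q = "SIGMA i:{1..r}. {i<..r}"
  have "bij_betw (\<lambda>(i, j). {i, j}) ?Q {p. p \<subseteq> {1..r} \<and> card p = 2}"
  proof (rule bij_betwI')
    fix x y assume "x \<in> ?Q" "y \<in> ?Q"
    then show "((case x of (i, j) \<Rightarrow> {i, j}) = (case y of (i, j) \<Rightarrow> {i, j})) = (x = y)"
      by (auto simp: doubleton_eq_iff)
  next
    fix x assume "x \<in> ?Q"
    then show "(case x of (i, j) \<Rightarrow> {i, j}) \<in> {p. p \<subseteq> {1..r} \<and> card p = 2}" by auto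
  next
    fix p assume "p \<in> {p. p \<subseteq> {1..r} \<and> card p = 2}"
    then obtain a b where ab: "p = {a, b}" "a \<noteq> b" "a \<in> {1..r}" "b \<in> {1..r}"
      by (auto simp: card_2_iff)
    show "\<exists>x\<in>?Q. p = (case x of (i, j) \<Rightarrow> {i, j})"
    proof (cases "a < b")
      case True
      then show ?thesis using ab by (intro bexI[of _ "(a, b)"]) auto
    next
      case False
      then show ?thesis using ab by (intro bexI[of _ "(b, a)"]) auto
    qed
  qed
  from sum.reindex_bij_betw[OF this, of \<alpha>] show ?thesis
    by (simp add: la_weight_def sum.Sigma split_def)
qed

lemma la_weight_le:
  assumes "\<forall>i\<in>{1..r}. (\<Sum>j\<in>{1..r} - {i}. \<alpha> {i, j}) \<le> l"
  shows "la_weight r \<alpha> \<le> r * l"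
proof -
  have "(\<Sum>j\<in>{i<..r}. \<alpha> {i, j}) \<le> l" if i: "i \<in> {1..r}" for i
  proof -
    have "(\<Sum>j\<in>{i<..r}. \<alpha> {i, j}) \<le> (\<Sum>j\<in>{1..r} - {i}. \<alpha> {i, j})"
      using i by (intro sum_mono2) auto
    then show ?thesis using assms i by fastforce
  qed
  from sum_mono[of "{1..r}", OF this] show ?thesis by (simp add: la_weight_eq)
qed

text \<open>One more than the largest table index \<open>r * r + r\<close>, so that digits are
  addressed exactly like the cells of the table for \<open>\<alpha>\<close>.\<close>

definition num_digits :: "nat \<Rightarrow> nat" where
  "num_digits r = r * r + r + 1"

definition digit_vectors :: "nat \<Rightarrow> nat \<Rightarrow> nat \<Rightarrow> (nat \<Rightarrow> nat) set" where
  "digit_vectors m l K = {a. (\<forall>p<m. a p \<le> l) \<and> (\<forall>p\<ge>m. a p = 0) \<and> (\<Sum>p<m. a p) \<le> K}"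

text \<open>Digits at positions that belong to no pair \<open>i < j\<close> are set to 0. Then the
  digit sum is exactly the weight, and \<open>la_weight_le\<close> applies.\<close>

lemma exists_digit_vector:
  assumes "\<forall>i\<in>{1..r}. (\<Sum>j\<in>{1..r} - {i}. \<alpha> {i, j}) \<le> l"
  shows "\<exists>a\<in>digit_vectors (num_digits r) l (r * l).
    \<forall>i\<in>{1..r}. \<forall>j\<in>{1..r}. i \<noteq> j \<longrightarrow> cut_size r a {i, j} = \<alpha> {i, j}"
proof -
  let ?Q = "SIGMA i:{1..r}. {i<..r}" and ?f = "\<lambda>(i, j). i * r + j"
  have Q: "i \<in> {1..r} \<and> j \<in> {1..r} \<and> i < j" if "(i, j) \<in> ?Q" for i j
    using that by auto
  have inj: "inj_on ?f ?Q"
    by (rule inj_onI) (use Q row_major_inj_labels in fastforce)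
  define a where "a p = (if p \<in> ?f ` ?Q then \<alpha> (case inv_into ?Q ?f p of (i, j) \<Rightarrow> {i, j}) else 0)" for p
  have a: "a (i * r + j) = \<alpha> {i, j}" if "(i, j) \<in> ?Q" for i j
  proof -
    have "inv_into ?Q ?f (?f (i, j)) = (i, j)" by (rule inv_into_f_f[OF inj that])
    moreover have "?f (i, j) \<in> ?f ` ?Q" using that by (rule imageI)
    ultimately show ?thesis unfolding a_def by simp
  qed
  have sub: "?f ` ?Q \<subseteq> {..<num_digits r}"
  proof
    fix p assume "p \<in> ?f ` ?Q"
    then obtain i j where ij: "(i, j) \<in> ?Q" "p = i * r + j" by (rule imageE) (auto split: prod.splits simp del: One_nat_def)
    then have "i * r \<le> r * r" "j \<le> r" by (auto intro: mult_le_mono1)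
    then have "p \<le> r * r + r" using ij(2) by linarith
    then show "p \<in> {..<num_digits r}" by (simp add: num_digits_def)
  qed
  have le: "\<alpha> {i, j} \<le> l" if "(i, j) \<in> ?Q" for i j
  proof -
    have "i \<in> {1..r}" "j \<in> {1..r} - {i}" using that by auto
    then have "\<alpha> {i, j} \<le> (\<Sum>j\<in>{1..r} - {i}. \<alpha> {i, j})"
      by (intro member_le_sum) auto
    then show ?thesis using assms \<open>i \<in> {1..r}\<close> by fastforce
  qed
  have "(\<Sum>p<num_digits r. a p) = (\<Sum>p\<in>?f ` ?Q. a p)"
    using sub by (intro sum.mono_neutral_right) (auto simp: a_def)
  also have "\<dots> = (\<Sum>(i, j)\<in>?Q. a (i * r + j))"
    by (subst sum.reindex[OF inj]) (simp add: o_def split_def)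
  also have "\<dots> = (\<Sum>(i, j)\<in>?Q. \<alpha> {i, j})"
    using a by (intro sum.cong) auto
  also have "\<dots> = la_weight r \<alpha>"
    by (simp add: la_weight_eq sum.Sigma)
  also have "\<dots> \<le> r * l" by (rule la_weight_le[OF assms])
  finally have "(\<Sum>p<num_digits r. a p) \<le> r * l" .
  moreover have "a p \<le> l" for p
  proof (cases "p \<in> ?f ` ?Q")
    case True
    then obtain i j where "(i, j) \<in> ?Q" "p = i * r + j" by (rule imageE) (auto split: prod.splits simp del: One_nat_def)
    then show ?thesis using a[of i j] le[of i j] by simp
  qed (simp add: a_def)
  moreover have "a p = 0" if "p \<ge> num_digits r" for p
    using sub that by (auto simp: a_def)
  ultimately have "a \<in> digit_vectors (num_digits r) l (r * l)"
    by (simp add: digit_vectors_def)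
  moreover have "cut_size r a {i, j} = \<alpha> {i, j}" if "i \<in> {1..r}" "j \<in> {1..r}" "i \<noteq> j" for i j
  proof (cases "i < j")
    case True
    then show ?thesis using a[of i j] that by (simp add: cut_size_pair)
  next
    case False
    then show ?thesis using a[of j i] that by (simp add: cut_size_pair insert_commute[of i])
  qed
  ultimately show ?thesis by blast
qed

subsection \<open>Counting digit vectors\<close>

text \<open>Digit vectors are 0 from \<open>m\<close> on, functions in \<open>PiE\<close> are
  \<open>undefined\<close> there. Restriction passes from one convention to the other and loses
  nothing.\<close>

lemma digit_vectors_subset_PiE:
  "\<exists>f. inj_on f (digit_vectors m l K) \<and> f ` digit_vectors m l K \<subseteq> PiE {..<m} (\<lambda>_. {..l})"
proof (intro exI conjI)
  show "inj_on (\<lambda>a. restrict a {..<m}) (digit_vectors m l K)"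
  proof (rule inj_onI, rule ext)
    fix a b p assume *: "a \<in> digit_vectors m l K" "b \<in> digit_vectors m l K"
      "restrict a {..<m} = restrict b {..<m}"
    show "a p = b p"
    proof (cases "p < m")
      case True
      then show ?thesis using fun_cong[OF *(3), of p] by simp
    next
      case False
      then show ?thesis using * by (simp add: digit_vectors_def)
    qed
  qed
qed (auto simp: digit_vectors_def split: if_splits)

lemma finite_digit_vectors: "finite (digit_vectors m l K)"
  and card_digit_vectors_le: "card (digit_vectors m l K) \<le> (l + 1) ^ m"
proof -
  obtain f where f: "inj_on f (digit_vectors m l K)"
    "f ` digit_vectors m l K \<subseteq> PiE {..<m} (\<lambda>_. {..l})"
    using digit_vectors_subset_PiE by blast
  have fin: "finite (PiE {..<m} (\<lambda>_. {..l}))" by (intro finite_PiE) auto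
  show "finite (digit_vectors m l K)"
    using f fin by (metis finite_imageD finite_subset)
  have "card (digit_vectors m l K) \<le> card (PiE {..<m} (\<lambda>_. {..l}))"
    using card_inj_on_le[OF f fin] .
  then show "card (digit_vectors m l K) \<le> (l + 1) ^ m" by (simp add: card_PiE)
qed

text \<open>A vector with sum at most \<open>Suc K\<close> arises from one with sum at most
  \<open>K\<close> by raising one of \<open>m\<close> positions or by no change, hence
  \<open>m + 1\<close> choices per unit of \<open>K\<close>. Finiteness is carried along because the
  cardinality estimate of the step relies on it.\<close>

lemma card_sum_bounded:
  "finite {a :: nat \<Rightarrow> nat. (\<forall>p\<ge>m. a p = 0) \<and> (\<Sum>p<m. a p) \<le> K} \<and>
   card {a :: nat \<Rightarrow> nat. (\<forall>p\<ge>m. a p = 0) \<and> (\<Sum>p<m. a p) \<le> K} \<le> (m + 1) ^ K"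
proof (induction K)
  case 0
  have "{a :: nat \<Rightarrow> nat. (\<forall>p\<ge>m. a p = 0) \<and> (\<Sum>p<m. a p) \<le> 0} = {\<lambda>_. 0}"
    by (auto intro!: ext) (metis leI lessThan_iff)
  then show ?case by simp
next
  case (Suc K)
  let ?S = "\<lambda>K. {a :: nat \<Rightarrow> nat. (\<forall>p\<ge>m. a p = 0) \<and> (\<Sum>p<m. a p) \<le> K}"
  \<comment> \<open>The value \<open>q = m\<close> stands for no change.\<close>
  let ?f = "\<lambda>(q, a :: nat \<Rightarrow> nat). if q = m then a else a(q := Suc (a q))"
  have "?S (Suc K) \<subseteq> ?f ` ({..m} \<times> ?S K)"
  proof
    fix a assume a: "a \<in> ?S (Suc K)"
    show "a \<in> ?f ` ({..m} \<times> ?S K)"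
    proof (cases "\<exists>q<m. a q > 0")
      case False
      then have "a \<in> ?S K" using a by simp
      then show ?thesis by (intro image_eqI[of _ _ "(m, a)"]) auto
    next
      case True
      then obtain q where q: "q < m" "a q > 0" by blast
      define b where "b = a(q := a q - 1)"
      have "(\<Sum>p<m. a p) = a q + (\<Sum>p\<in>{..<m} - {q}. a p)"
        "(\<Sum>p<m. b p) = b q + (\<Sum>p\<in>{..<m} - {q}. b p)"
        using q by (auto intro: sum.remove)
      moreover have "(\<Sum>p\<in>{..<m} - {q}. b p) = (\<Sum>p\<in>{..<m} - {q}. a p)"
        by (intro sum.cong) (auto simp: b_def)
      ultimately have "Suc (\<Sum>p<m. b p) = (\<Sum>p<m. a p)"
        using q by (simp add: b_def)
      then have "b \<in> ?S K" using a q by (auto simp: b_def)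
      moreover have "a = ?f (q, b)" using q by (auto simp: b_def)
      ultimately show ?thesis using q by (intro image_eqI[of _ _ "(q, b)"]) auto
    qed
  qed
  moreover have fin: "finite ({..m} \<times> ?S K)" using Suc by simp
  ultimately have "finite (?S (Suc K))" "card (?S (Suc K)) \<le> card ({..m} \<times> ?S K)"
    by (auto intro: finite_subset surj_card_le)
  moreover have "card ({..m} \<times> ?S K) \<le> (m + 1) ^ Suc K"
    using mult_le_mono2[of _ _ "m + 1"] Suc by (simp only: card_cartesian_product card_atMost power_Suc) simp
  ultimately show ?case by linarith
qed

lemma card_digit_vectors_le': "card (digit_vectors m l K) \<le> (m + 1) ^ K"
proof -
  have "card (digit_vectors m l K) \<le> card {a :: nat \<Rightarrow> nat. (\<forall>p\<ge>m. a p = 0) \<and> (\<Sum>p<m. a p) \<le> K}"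
    using card_sum_bounded[of m K] by (intro card_mono) (auto simp: digit_vectors_def)
  then show ?thesis using card_sum_bounded[of m K] by linarith
qed

subsection \<open>Lexicographic successor\<close>

text \<open>The highest differing position decides, so position 0 is the least significant
  digit.\<close>

definition lex_less :: "(nat \<Rightarrow> nat) \<Rightarrow> (nat \<Rightarrow> nat) \<Rightarrow> bool" where
  "lex_less a b \<longleftrightarrow> (\<exists>p. a p < b p \<and> (\<forall>q>p. a q = b q))"

definition incr :: "nat \<Rightarrow> (nat \<Rightarrow> nat) \<Rightarrow> nat \<Rightarrow> nat" where
  "incr p a = (\<lambda>q. if q < p then 0 else if q = p then Suc (a q) else a q)"

text \<open>The sum omits the positions below \<open>p\<close>, since \<open>incr p\<close> clears
  them. The two strict inequalities leave room for the added unit.\<close>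

definition can_incr :: "nat \<Rightarrow> nat \<Rightarrow> nat \<Rightarrow> (nat \<Rightarrow> nat) \<Rightarrow> nat \<Rightarrow> bool" where
  "can_incr m l K a p \<longleftrightarrow> a p < l \<and> (\<Sum>q\<in>{p..<m}. a q) < K"

lemma lex_less_irrefl: "\<not> lex_less a a"
  by (simp add: lex_less_def)

lemma lex_less_trans:
  assumes "lex_less a b" "lex_less b c" shows "lex_less a c"
proof -
  obtain p q where p: "a p < b p" "\<forall>x>p. a x = b x" and q: "b q < c q" "\<forall>x>q. b x = c x"
    using assms by (auto simp: lex_less_def)
  consider "p < q" | "p = q" | "q < p" by linarith
  then show ?thesis
  proof cases
    case 1 then show ?thesis using p q unfolding lex_less_def by (intro exI[of _ q]) auto
  next
    case 2 then show ?thesis using p q unfolding lex_less_def by (intro exI[of _ q]) auto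
  next
    case 3 then show ?thesis using p q unfolding lex_less_def by (intro exI[of _ p]) auto
  qed
qed

lemma zero_or_lex_less:
  assumes "\<forall>q\<ge>m. b q = 0"
  shows "b = (\<lambda>_. 0) \<or> lex_less (\<lambda>_. 0) b"
proof (cases "b = (\<lambda>_. 0)")
  case False
  let ?D = "{q. b q \<noteq> 0}"
  have "?D \<subseteq> {..<m}" using assms by (force intro: ccontr)
  then have fin: "finite ?D" by (rule finite_subset) simp
  have "?D \<noteq> {}" using False by (auto simp: fun_eq_iff)
  then have "b (Max ?D) \<noteq> 0" using Max_in[OF fin] by auto
  moreover have "\<forall>q>Max ?D. 0 = b q"
    using Max_ge[OF fin] by (metis (mono_tags, lifting) leD mem_Collect_eq)
  ultimately show ?thesis unfolding lex_less_def by blast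
qed simp

lemma lex_less_incr: "lex_less a (incr p a)"
  unfolding lex_less_def incr_def by (intro exI[of _ p]) auto

lemma sum_incr:
  assumes "p < m"
  shows "(\<Sum>q<m. incr p a q) = Suc (\<Sum>q\<in>{p..<m}. a q)"
proof -
  have "(\<Sum>q<m. incr p a q) = (\<Sum>q\<in>{p..<m}. incr p a q)"
    by (rule sum.mono_neutral_right) (auto simp: incr_def)
  also have "\<dots> = incr p a p + (\<Sum>q\<in>{Suc p..<m}. incr p a q)"
    using assms by (rule sum.atLeast_Suc_lessThan)
  also have "(\<Sum>q\<in>{Suc p..<m}. incr p a q) = (\<Sum>q\<in>{Suc p..<m}. a q)"
    by (intro sum.cong) (auto simp: incr_def)
  also have "incr p a p + (\<Sum>q\<in>{Suc p..<m}. a q) = Suc (\<Sum>q\<in>{p..<m}. a q)"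
    using sum.atLeast_Suc_lessThan[OF assms, of a] by (simp add: incr_def)
  finally show ?thesis .
qed

lemma incr_in_digit_vectors:
  assumes "a \<in> digit_vectors m l K" "p < m" "can_incr m l K a p"
  shows "incr p a \<in> digit_vectors m l K"
  using assms sum_incr[OF assms(2), of a] by (auto simp: digit_vectors_def can_incr_def incr_def)

text \<open>At the deciding position \<open>b\<close> witnesses that there is room: its digit there
  is larger than that of \<open>a\<close> and at most \<open>l\<close>, and its sum from there on is
  larger and at most \<open>K\<close>. This one fact yields both that the successor is least and
  that a vector without successor is maximal.\<close>

lemma lex_less_can_incr:
  assumes a: "a \<in> digit_vectors m l K" and b: "b \<in> digit_vectors m l K"
    and p: "a p < b p" "\<forall>q>p. a q = b q"
  shows "p < m" "can_incr m l K a p"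
proof -
  show pm: "p < m" using p b by (intro ccontr[of "p < m"]) (auto simp: digit_vectors_def)
  have "(\<Sum>q\<in>{p..<m}. a q) < (\<Sum>q\<in>{p..<m}. b q)"
  proof (rule sum_strict_mono_ex1)
    show "\<forall>q\<in>{p..<m}. a q \<le> b q" using p by (metis atLeastLessThan_iff le_less order.refl)
    show "\<exists>q\<in>{p..<m}. a q < b q" using p pm by (intro bexI[of _ p]) auto
  qed simp
  also have "\<dots> \<le> (\<Sum>q<m. b q)" by (intro sum_mono2) auto
  also have "\<dots> \<le> K" using b by (simp add: digit_vectors_def)
  finally show "can_incr m l K a p"
    using p pm b by (fastforce simp: can_incr_def digit_vectors_def)
qed

text \<open>No position below \<open>p\<close> can be incremented, so \<open>a\<close> and
  \<open>b\<close> are decided at \<open>p\<close> or higher. As \<open>incr p a\<close> raises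
  position \<open>p\<close> by only one and is zero below, it cannot overtake
  \<open>b\<close>.\<close>

lemma incr_least:
  assumes a: "a \<in> digit_vectors m l K" and b: "b \<in> digit_vectors m l K" and ab: "lex_less a b"
    and least: "\<forall>q<p. \<not> can_incr m l K a q"
  shows "b = incr p a \<or> lex_less (incr p a) b"
proof -
  obtain p' where p': "a p' < b p'" "\<forall>q>p'. a q = b q"
    using ab by (auto simp: lex_less_def)
  have "p \<le> p'" using lex_less_can_incr[OF a b p'] least by (intro ccontr[of "p \<le> p'"]) auto
  then consider "p < p'" | "p = p'" "Suc (a p) < b p" | "p = p'" "b p = Suc (a p)"
    using p'(1) by (metis Suc_lessI le_neq_implies_less)
  then show ?thesis
  proof cases
    case 1
    then show ?thesis using p' unfolding lex_less_def incr_def by (intro disjI2 exI[of _ p']) auto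
  next
    case 2
    then show ?thesis using p' unfolding lex_less_def incr_def by (intro disjI2 exI[of _ p']) auto
  next
    case 3
    \<comment> \<open>\<open>c\<close> is the part of \<open>b\<close> below \<open>p\<close>, where
      \<open>incr p a\<close> is zero. Comparing \<open>c\<close> with the zero vector settles the
      tie.\<close>
    define c where "c q = (if q < p then b q else 0)" for q
    have "c = (\<lambda>_. 0) \<or> lex_less (\<lambda>_. 0) c"
      by (rule zero_or_lex_less[of p]) (simp add: c_def)
    then show ?thesis
    proof
      assume "c = (\<lambda>_. 0)"
      then have "\<forall>q<p. b q = 0" by (auto simp: c_def fun_eq_iff split: if_splits)
      then have "b = incr p a" using 3 p' by (auto simp: incr_def fun_eq_iff)
      then show ?thesis ..
    next
      assume "lex_less (\<lambda>_. 0) c"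
      then obtain x where "0 < c x" "\<forall>q>x. c q = 0" by (auto simp: lex_less_def)
      then have "x < p" "0 < b x" "\<forall>q. x < q \<and> q < p \<longrightarrow> b q = 0"
        by (auto simp: c_def split: if_splits)
      then show ?thesis
        using 3 p' unfolding lex_less_def incr_def by (intro disjI2 exI[of _ x]) auto
    qed
  qed
qed

lemma no_incr_maximal:
  assumes "a \<in> digit_vectors m l K" "b \<in> digit_vectors m l K" "\<forall>q<m. \<not> can_incr m l K a q"
  shows "\<not> lex_less a b"
  using lex_less_can_incr[OF assms(1,2)] assms(3) unfolding lex_less_def by blast

section \<open>Padded instances\<close>

locale padded_terminals = numbered_terminals G r X num
  for G :: "('v, nat) mgraph" and r X num +
  fixes l :: nat and t1 t2 :: 'v
  assumes r: "2 \<le> r"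
    and t1: "t1 \<in> X" "num t1 = 1" and t2: "t2 \<in> X" "num t2 = 2"
begin

text \<open>The two terminals lie in classes 1 and 2 of every allocation, so parallel edges between them
  raise the weight to exactly \<open>r * l\<close> without affecting solvability.\<close>

definition slack :: "(nat \<Rightarrow> nat) \<Rightarrow> nat" where
  "slack a = r * l - la_weight r (cut_size r a)"

definition padded_graph :: "(nat \<Rightarrow> nat) \<Rightarrow> ('v, nat) mgraph" where
  "padded_graph a = add_edges G (slack a) t1 t2"

definition padded_size :: "(nat \<Rightarrow> nat) \<Rightarrow> nat set \<Rightarrow> nat" where
  "padded_size a p = cut_size r a p + (if p = {1, 2} then slack a else 0)"

definition feasible :: "(nat \<Rightarrow> nat) \<Rightarrow> bool" where
  "feasible a \<longleftrightarrow> row_ok r l a \<and> (\<exists>\<V>. la_solution (padded_graph a) r lists (padded_size a) \<V>)"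

lemma wf: "wf_mgraph G" "X \<subseteq> verts G" "finite X" "card X = r"
  using inst finite_subset by (auto simp: mmc_instance_def wf_mgraph_def)

lemma terminals_distinct: "t1 \<noteq> t2"
  using t1 t2 by auto

lemma delta_padded_graph:
  "card (delta (padded_graph a) A B) =
    card (delta G A B) + (if t1 \<in> A \<and> t2 \<in> B \<or> t2 \<in> A \<and> t1 \<in> B then slack a else 0)"
  unfolding padded_graph_def by (rule delta_add_edges[OF wf(1)])

lemma padded_instance: "la_instance (padded_graph a) r lists"
proof -
  have "wf_mgraph (padded_graph a)"
    unfolding padded_graph_def using t1 t2 wf terminals_distinct by (intro wf_add_edges) auto
  moreover have "lists v \<subseteq> {1..r}" for v
    using num by (auto simp: lists_def bij_betw_def)
  ultimately show ?thesis using r by (simp add: la_instance_def)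
qed

text \<open>\<open>row_ok\<close> bounds the unpadded weight by \<open>r * l\<close>, so the
  truncated subtraction in \<open>slack\<close> is exact.\<close>

lemma padded_weight: "row_ok r l a \<Longrightarrow> la_weight r (padded_size a) = r * l"
  using la_weight_le[of r "cut_size r a" l] la_weight_pair[OF r, of "cut_size r a" "slack a"]
  by (simp add: row_ok_def padded_size_def[abs_def] slack_def)

text \<open>The lists put \<open>t1\<close> into class 1 and \<open>t2\<close> into class 2. So the
  new edges raise only the count for \<open>{1, 2}\<close>, by the amount that
  \<open>padded_size\<close> adds there, and the two contributions cancel.\<close>

lemma la_solution_padded:
  "la_solution (padded_graph a) r lists (padded_size a) \<V> \<longleftrightarrow>
     allocation r (verts G) \<V> \<and> (\<forall>i\<in>{1..r}. \<forall>v\<in>\<V> i. i \<in> lists v) \<and>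
     (\<forall>i\<in>{1..r}. \<forall>j\<in>{1..r}. i \<noteq> j \<longrightarrow> card (delta G (\<V> i) (\<V> j)) = cut_size r a {i, j})"
proof -
  have "card (delta (padded_graph a) (\<V> i) (\<V> j)) = padded_size a {i, j} \<longleftrightarrow>
      card (delta G (\<V> i) (\<V> j)) = cut_size r a {i, j}"
    if "allocation r (verts G) \<V>" "\<forall>i\<in>{1..r}. \<forall>v\<in>\<V> i. i \<in> lists v"
      and ij: "i \<in> {1..r}" "j \<in> {1..r}" for i j
  proof -
    have "t1 \<in> \<V> k \<longleftrightarrow> k = 1" "t2 \<in> \<V> k \<longleftrightarrow> k = 2" if "k \<in> {1..r}" for k
      using allocation_terminal[OF \<open>allocation r (verts G) \<V>\<close> \<open>\<forall>i\<in>{1..r}. \<forall>v\<in>\<V> i. i \<in> lists v\<close>, of _ k]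
        that t1 t2 by auto
    then show ?thesis
      using ij by (auto simp: delta_padded_graph padded_size_def doubleton_eq_iff)
  qed
  moreover have "verts (padded_graph a) = verts G" by (simp add: padded_graph_def)
  ultimately show ?thesis unfolding la_solution_def by (auto simp del: One_nat_def)
qed

lemma solution_of_padded:
  assumes "row_ok r l a" "la_solution (padded_graph a) r lists (padded_size a) \<V>"
  shows "mmc_solution G l r X (\<V> ` {1..r})"
proof (rule solution_of_allocation)
  have *: "(\<Sum>j\<in>{1..r} - {i}. card (delta G (\<V> i) (\<V> j))) = (\<Sum>j\<in>{1..r} - {i}. cut_size r a {i, j})"
    if "i \<in> {1..r}" for i
    using assms(2) that unfolding la_solution_padded by (intro sum.cong) auto
  show "multiway_allocation G l r lists \<V>"
    using assms * unfolding la_solution_padded multiway_allocation_def row_ok_def by auto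
qed

lemma feasible_of_solution:
  assumes "mmc_solution G l r X \<P>"
  shows "\<exists>a\<in>digit_vectors (num_digits r) l (r * l). feasible a"
proof -
  obtain \<V> where \<V>: "multiway_allocation G l r lists \<V>"
    using allocation_of_solution[OF assms] by blast
  \<comment> \<open>\<open>Min\<close> and \<open>Max\<close> make this a function of the unordered
    pair; by the symmetry of \<open>delta\<close> it agrees with both orders.\<close>
  define \<alpha> where "\<alpha> p = card (delta G (\<V> (Min p)) (\<V> (Max p)))" for p
  have \<alpha>: "\<alpha> {i, j} = card (delta G (\<V> i) (\<V> j))" for i j
    by (cases "i \<le> j") (auto simp: \<alpha>_def delta_commute[of G "\<V> i"] min_def max_def)
  have "\<forall>i\<in>{1..r}. (\<Sum>j\<in>{1..r} - {i}. \<alpha> {i, j}) \<le> l"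
    using \<V> by (simp add: \<alpha> multiway_allocation_def)
  then obtain a where a: "a \<in> digit_vectors (num_digits r) l (r * l)"
    "\<forall>i\<in>{1..r}. \<forall>j\<in>{1..r}. i \<noteq> j \<longrightarrow> cut_size r a {i, j} = \<alpha> {i, j}"
    using exists_digit_vector by blast
  have "(\<Sum>j\<in>{1..r} - {i}. cut_size r a {i, j}) = (\<Sum>j\<in>{1..r} - {i}. \<alpha> {i, j})"
    if "i \<in> {1..r}" for i
    using a(2) that by (intro sum.cong) auto
  then have "row_ok r l a"
    using \<V> by (simp add: row_ok_def \<alpha> multiway_allocation_def)
  moreover have "la_solution (padded_graph a) r lists (padded_size a) \<V>"
    unfolding la_solution_padded using \<V> a(2) \<alpha> by (simp add: multiway_allocation_def)
  ultimately show ?thesis using a(1) by (auto simp: feasible_def)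
qed

end

section \<open>Timed Hoare triples\<close>

text \<open>Total correctness with an upper bound on the steps. Bounds are natural numbers; the
  real-valued \<open>T\<close> will enter through its floor, which loses nothing for step
  counts.\<close>

definition triple :: "(state \<Rightarrow> bool) \<Rightarrow> com \<Rightarrow> nat \<Rightarrow> (state \<Rightarrow> bool) \<Rightarrow> bool" where
  "triple A c b B \<longleftrightarrow> (\<forall>s. A s \<longrightarrow> (\<exists>k s'. exec c s k s' \<and> k \<le> b \<and> B s'))"

lemma tripleI: "(\<And>s. A s \<Longrightarrow> \<exists>k s'. exec c s k s' \<and> k \<le> b \<and> B s') \<Longrightarrow> triple A c b B"
  by (simp add: triple_def)

lemma tripleE:
  assumes "triple A c b B" "A s"
  obtains k s' where "exec c s k s'" "k \<le> b" "B s'"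
  using assms by (auto simp: triple_def)

lemma triple_conseq:
  assumes "triple A c b B" "\<And>s. A' s \<Longrightarrow> A s" "\<And>s. B s \<Longrightarrow> B' s" "b \<le> b'"
  shows "triple A' c b' B'"
  using assms unfolding triple_def by (meson order_trans)

lemma triple_Seq:
  assumes "triple A c1 b1 B" "triple B c2 b2 C"
  shows "triple A (Seq c1 c2) (b1 + b2) C"
  using assms unfolding triple_def by (meson add_mono exec.Seq)

lemma triple_assoc:
  assumes "triple A (Seq (Seq c1 c2) c3) b B" shows "triple A (Seq c1 (Seq c2 c3)) b B"
proof (rule tripleI)
  fix s assume "A s"
  then obtain k s' where k: "exec (Seq (Seq c1 c2) c3) s k s'" "k \<le> b" "B s'"
    using assms unfolding triple_def by meson
  have "exec (Seq c1 (Seq c2 c3)) s k s'"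
    using k(1) by (elim SeqE) (simp add: add.assoc exec.Seq)
  then show "\<exists>k s'. exec (Seq c1 (Seq c2 c3)) s k s' \<and> k \<le> b \<and> B s'"
    using k by blast
qed

lemma triple_If:
  assumes "triple (\<lambda>s. A s \<and> regs s x \<noteq> 0) c1 b B" "triple (\<lambda>s. A s \<and> regs s x = 0) c2 b B"
  shows "triple A (IfNZ x c1 c2) (1 + b) B"
proof (rule tripleI)
  fix s assume "A s"
  show "\<exists>k s'. exec (IfNZ x c1 c2) s k s' \<and> k \<le> 1 + b \<and> B s'"
  proof (cases "regs s x = 0")
    case True
    then obtain k s' where "exec c2 s k s'" "k \<le> b" "B s'"
      using assms(2) \<open>A s\<close> by (auto simp: triple_def)
    then show ?thesis using exec.IfFalse[OF True] by (metis add_le_cancel_left)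
  next
    case False
    then obtain k s' where "exec c1 s k s'" "k \<le> b" "B s'"
      using assms(1) \<open>A s\<close> by (auto simp: triple_def)
    then show ?thesis using exec.IfTrue[OF False] by (metis add_le_cancel_left)
  qed
qed

text \<open>The index of \<open>I\<close> is a variant that bounds the rounds left; it may drop by
  more than one. Each round costs one test besides its body, and one last test ends the
  loop.\<close>

lemma triple_While:
  assumes body: "\<And>m. triple (\<lambda>s. I m s \<and> regs s x \<noteq> 0) c b (\<lambda>s. \<exists>m'<m. I m' s)"
  shows "triple (I m) (WhileNZ x c) (m * (b + 1) + 1) (\<lambda>s. \<exists>m'. I m' s \<and> regs s x = 0)"
proof (rule tripleI)
  fix s assume "I m s"
  then show "\<exists>k s'. exec (WhileNZ x c) s k s' \<and> k \<le> m * (b + 1) + 1 \<and> (\<exists>m'. I m' s' \<and> regs s' x = 0)"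
  proof (induction m arbitrary: s rule: less_induct)
    case (less m)
    show ?case
    proof (cases "regs s x = 0")
      case True
      then show ?thesis using less.prems exec.WhileFalse[OF True]
        by (intro exI[of _ 1] exI[of _ s]) auto
    next
      case False
      then obtain k1 s1 m' where 1: "exec c s k1 s1" "k1 \<le> b" "m' < m" "I m' s1"
        using body[of m] less.prems unfolding triple_def by blast
      from less.IH[OF 1(3,4)] obtain k2 s2 where 2: "exec (WhileNZ x c) s1 k2 s2"
        "k2 \<le> m' * (b + 1) + 1" "\<exists>m'. I m' s2 \<and> regs s2 x = 0" by blast
      have "Suc m' * (b + 1) \<le> m * (b + 1)" using 1(3) by (intro mult_le_mono1) simp
      then have "1 + k1 + k2 \<le> m * (b + 1) + 1" using 1(2) 2(2) by simp
      then show ?thesis using exec.WhileTrue[OF False 1(1) 2(1)] 2(3) by blast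
    qed
  qed
qed

section \<open>Symbolic execution of loop-free programs\<close>

fun loop_free :: "com \<Rightarrow> bool" where
  "loop_free (Seq c1 c2) \<longleftrightarrow> loop_free c1 \<and> loop_free c2"
| "loop_free (IfNZ x c1 c2) \<longleftrightarrow> loop_free c1 \<and> loop_free c2"
| "loop_free (WhileNZ x c) \<longleftrightarrow> False"
| "loop_free _ \<longleftrightarrow> True"

fun run :: "com \<Rightarrow> state \<Rightarrow> state" where
  "run (Const x c) s = s\<lparr>regs := (regs s)(x := c)\<rparr>"
| "run (Add x y z) s = s\<lparr>regs := (regs s)(x := regs s y + regs s z)\<rparr>"
| "run (Sub x y z) s = s\<lparr>regs := (regs s)(x := regs s y - regs s z)\<rparr>"
| "run (Load x a y) s = s\<lparr>regs := (regs s)(x := arrs s a (regs s y))\<rparr>"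
| "run (Store a x y) s = s\<lparr>arrs := (arrs s)(a := (arrs s a)(regs s x := regs s y))\<rparr>"
| "run (Seq c1 c2) s = run c2 (run c1 s)"
| "run (IfNZ x c1 c2) s = (if regs s x \<noteq> 0 then run c1 s else run c2 s)"
| "run _ s = s"

fun cost :: "com \<Rightarrow> nat" where
  "cost (Seq c1 c2) = cost c1 + cost c2"
| "cost (IfNZ x c1 c2) = 1 + max (cost c1) (cost c2)"
| "cost _ = 1"

lemma exec_run: "loop_free c \<Longrightarrow> \<exists>k. exec c s k (run c s) \<and> k \<le> cost c"
proof (induction c arbitrary: s)
  case (Seq c1 c2)
  obtain k1 where 1: "exec c1 s k1 (run c1 s)" "k1 \<le> cost c1" using Seq by auto
  obtain k2 where 2: "exec c2 (run c1 s) k2 (run c2 (run c1 s))" "k2 \<le> cost c2" using Seq by force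
  show ?case using exec.Seq[OF 1(1) 2(1)] 1(2) 2(2) by auto
next
  case (IfNZ x c1 c2)
  obtain k1 where 1: "exec c1 s k1 (run c1 s)" "k1 \<le> cost c1" using IfNZ by auto
  obtain k2 where 2: "exec c2 s k2 (run c2 s)" "k2 \<le> cost c2" using IfNZ by force
  show ?case
  proof (cases "regs s x = 0")
    case True
    then show ?thesis using exec.IfFalse[OF True 2(1), of c1] 2(2) by (intro exI[of _ "1 + k2"]) auto
  next
    case False
    then show ?thesis using exec.IfTrue[OF False 1(1), of c2] 1(2) by (intro exI[of _ "1 + k1"]) auto
  qed
qed (force intro: exec.intros[unfolded One_nat_def])+

text \<open>Reduces a triple for loop-free code to simplification with \<open>run\<close>;
  \<open>cost\<close> charges the longer branch of a conditional.\<close>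

lemma triple_run:
  assumes "loop_free c" "\<And>s. A s \<Longrightarrow> B (run c s)" "cost c \<le> b"
  shows "triple A c b B"
  using assms exec_run unfolding triple_def by (meson order_trans)

text \<open>Without a comparison instruction, \<open>t\<close> holds the truncated difference
  \<open>y - x\<close>, which is nonzero exactly while \<open>x < y\<close>. Setting
  \<open>one\<close> anew in each round makes the increment independent of the body.\<close>

definition for_loop :: "vname \<Rightarrow> vname \<Rightarrow> vname \<Rightarrow> vname \<Rightarrow> com \<Rightarrow> com" where
  "for_loop one t x y c = Seq (Const x 0) (Seq (Sub t y x)
     (WhileNZ t (Seq c (Seq (Const one 1) (Seq (Add x x one) (Sub t y x))))))"

text \<open>A round adds one test and three instructions to its body; the other 3 steps are two
  initialisations and the last test. The premise \<open>indep\<close> says that the invariant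
  tolerates changes of the counter registers, which lets nested loops share \<open>t\<close> and
  \<open>one\<close>.\<close>

lemma triple_for_loop:
  assumes dist: "distinct [one, t, x, y]"
    and bound: "\<And>i s. I i s \<Longrightarrow> regs s y = N"
    and indep: "\<And>i s a b. I i s \<Longrightarrow> I i (s\<lparr>regs := (regs s)(x := a, t := b, one := 1)\<rparr>)"
    and init: "\<And>s b. A s \<Longrightarrow> I 0 (s\<lparr>regs := (regs s)(x := 0, t := b)\<rparr>)"
    and body: "\<And>i. i < N \<Longrightarrow> triple (\<lambda>s. I i s \<and> regs s x = i) c b (\<lambda>s. I (Suc i) s \<and> regs s x = i)"
  shows "triple A (for_loop one t x y c) (N * (b + 4) + 3) (I N)"
proof -
  have ne: "one \<noteq> t" "t \<noteq> one" "one \<noteq> x" "x \<noteq> one" "one \<noteq> y" "y \<noteq> one"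
    "t \<noteq> x" "x \<noteq> t" "t \<noteq> y" "y \<noteq> t" "x \<noteq> y" "y \<noteq> x"
    using dist by auto
  \<comment> \<open>The variant \<open>m\<close> is the value of \<open>t\<close>, the number of
    rounds left.\<close>
  let ?J = "\<lambda>m s. \<exists>i. i + m = N \<and> I i s \<and> regs s x = i \<and> regs s t = m"
  let ?c = "Seq c (Seq (Const one 1) (Seq (Add x x one) (Sub t y x)))"
  have step: "triple (\<lambda>s. I (Suc i) s \<and> regs s x = i) (Seq (Const one 1) (Seq (Add x x one) (Sub t y x))) 3
      (\<lambda>s. I (Suc i) s \<and> regs s x = Suc i \<and> regs s t = N - Suc i)" for i
  proof (rule triple_run)
    fix s assume s: "I (Suc i) s \<and> regs s x = i"
    have "run (Seq (Const one 1) (Seq (Add x x one) (Sub t y x))) s =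
        s\<lparr>regs := (regs s)(one := 1, x := Suc i, t := N - Suc i)\<rparr>"
      using s ne bound[of "Suc i" s] by simp
    also have "(regs s)(one := 1, x := Suc i, t := N - Suc i) =
        (regs s)(x := Suc i, t := N - Suc i, one := 1)"
      using dist by (auto simp: fun_eq_iff)
    finally have eq: "run (Seq (Const one 1) (Seq (Add x x one) (Sub t y x))) s =
        s\<lparr>regs := (regs s)(x := Suc i, t := N - Suc i, one := 1)\<rparr>" .
    show "I (Suc i) (run (Seq (Const one 1) (Seq (Add x x one) (Sub t y x))) s) \<and>
        regs (run (Seq (Const one 1) (Seq (Add x x one) (Sub t y x))) s) x = Suc i \<and>
        regs (run (Seq (Const one 1) (Seq (Add x x one) (Sub t y x))) s) t = N - Suc i"
      unfolding eq using indep[of "Suc i" s] s ne by simp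
  qed auto
  have "triple (\<lambda>s. ?J m s \<and> regs s t \<noteq> 0) ?c (b + 3) (\<lambda>s. \<exists>m'<m. ?J m' s)" for m
  proof (cases "0 < m \<and> m \<le> N")
    case True
    then have "triple (\<lambda>s. I (N - m) s \<and> regs s x = N - m) ?c (b + 3)
      (\<lambda>s. I (Suc (N - m)) s \<and> regs s x = Suc (N - m) \<and> regs s t = N - Suc (N - m))"
      by (intro triple_Seq[OF body step]) auto
    then show ?thesis
      by (rule triple_conseq) (use True in \<open>auto intro!: exI[of _ "m - 1"]\<close>)
  next
    case False
    then show ?thesis by (auto simp: triple_def)
  qed
  from triple_While[of ?J, OF this, of N]
  have loop: "triple (?J N) (WhileNZ t ?c) (N * (b + 4) + 1) (\<lambda>s. \<exists>m. ?J m s \<and> regs s t = 0)"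
    by (simp add: add.commute[of b])
  have "triple A (Seq (Const x 0) (Sub t y x)) 2 (?J N)"
  proof (rule triple_run)
    fix s assume s: "A s"
    have "regs s y = N"
      using bound[OF init[OF s]] ne by simp
    then show "?J N (run (Seq (Const x 0) (Sub t y x)) s)"
      using init[OF s, of N] ne by simp
  qed auto
  from triple_Seq[OF this loop]
  have "triple A (Seq (Seq (Const x 0) (Sub t y x)) (WhileNZ t ?c)) (N * (b + 4) + 3) (I N)"
    by (rule triple_conseq) auto
  then show ?thesis unfolding for_loop_def by (rule triple_assoc)
qed

section \<open>The program\<close>

abbreviation seq_com :: "com \<Rightarrow> com \<Rightarrow> com" (infixr \<open>;;\<close> 60) where
  "c1 ;; c2 \<equiv> Seq c1 c2"

text \<open>Abstract names of working registers and arrays, made concrete by \<open>fr\<close> once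
  \<open>P\<close> is known. Countability allows concrete names to be told apart by their
  lengths.\<close>

datatype slot =
    Zero | One | Test | I | J | Q | QT | D | Lab
  | N | R | L | RL | NN | M | I12 | I21
  | Cnt | Base | W | Row | OK | Tot | Found | Go | Cont
  | GraphA | NumA | TermA | TermBaseA | DigitA

instance slot :: countable by countable_datatype

text \<open>\<open>P\<close> may still read these names. That is harmless, since a solver is correct
  for arbitrary contents of the memory outside its input.\<close>

locale program =
  fixes P :: com and fr :: "slot \<Rightarrow> vname"
  assumes inj_fr: "inj fr"
    and unassigned: "fr x \<notin> assigned_regs P" "fr x \<notin> assigned_arrs P"
    and not_io: "fr x \<notin> {''n'', ''r'', ''l'', ''ans'', ''G'', ''T'', ''lambda'', ''alpha'', ''out''}"
begin

lemma fr_eq_iff [simp]: "fr x = fr y \<longleftrightarrow> x = y"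
  using inj_fr by (simp add: inj_eq)

lemma fr_not_io [simp]:
  "fr x \<noteq> ''n''" "fr x \<noteq> ''r''" "fr x \<noteq> ''l''" "fr x \<noteq> ''ans''" "fr x \<noteq> ''G''" "fr x \<noteq> ''T''"
  "fr x \<noteq> ''lambda''" "fr x \<noteq> ''alpha''" "fr x \<noteq> ''out''"
  "''n'' \<noteq> fr x" "''r'' \<noteq> fr x" "''l'' \<noteq> fr x" "''ans'' \<noteq> fr x" "''G'' \<noteq> fr x" "''T'' \<noteq> fr x"
  "''lambda'' \<noteq> fr x" "''alpha'' \<noteq> fr x" "''out'' \<noteq> fr x"
  using not_io[of x] by auto

abbreviation for_upto :: "slot \<Rightarrow> vname \<Rightarrow> com \<Rightarrow> com" where
  "for_upto x y c \<equiv> for_loop (fr One) (fr Test) (fr x) y c"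

definition init_regs :: com where
  "init_regs = Const (fr Zero) 0 ;; Const (fr One) 1 ;;
     Add (fr N) ''n'' (fr Zero) ;; Add (fr R) ''r'' (fr Zero) ;; Add (fr L) ''l'' (fr Zero) ;;
     Const (fr NN) 0 ;; Const (fr RL) 0 ;; Const (fr M) 1"

definition init_squares :: com where
  "init_squares = for_upto I (fr N) (Add (fr NN) (fr NN) (fr N))"

definition init_products :: com where
  "init_products = for_upto I (fr R) (Add (fr RL) (fr RL) (fr L) ;; Add (fr M) (fr M) (fr R)) ;;
     Add (fr M) (fr M) (fr R)"

definition save_graph :: com where
  "save_graph = for_upto I (fr NN) (Load (fr D) ''G'' (fr I) ;; Store (fr GraphA) (fr I) (fr D))"

text \<open>\<open>Cnt\<close> counts the terminals seen and so yields their ranks; 0 marks a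
  nonterminal. \<open>TermBaseA\<close> keeps \<open>v * n\<close>, accumulated in
  \<open>Base\<close>, from which the matrix cells of the two padding terminals are found.\<close>

definition number_terminals :: com where
  "number_terminals = (Const (fr Cnt) 0 ;; Const (fr Base) 0) ;;
     for_upto I (fr N)
       (Load (fr D) ''T'' (fr I) ;;
        IfNZ (fr D)
          (Add (fr Cnt) (fr Cnt) (fr One) ;; Store (fr NumA) (fr I) (fr Cnt) ;;
           Store (fr TermA) (fr Cnt) (fr I) ;; Store (fr TermBaseA) (fr Cnt) (fr Base))
          (Store (fr NumA) (fr I) (fr Zero)) ;;
        Add (fr Base) (fr Base) (fr N))"

definition terminal_cells :: com where
  "terminal_cells = Const (fr D) 2 ;;
     Load (fr Q) (fr TermBaseA) (fr One) ;; Load (fr QT) (fr TermA) (fr D) ;;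
     Add (fr I12) (fr Q) (fr QT) ;;
     Load (fr Q) (fr TermBaseA) (fr D) ;; Load (fr QT) (fr TermA) (fr One) ;;
     Add (fr I21) (fr Q) (fr QT)"

definition init_digits :: com where
  "init_digits = for_upto I (fr M) (Store (fr DigitA) (fr I) (fr Zero)) ;;
     Const (fr Tot) 0 ;; Const (fr Found) 0 ;; Const (fr Go) 1"

text \<open>Loop counters start at 0, labels at 1. \<open>Q\<close> runs through the cells
  \<open>(i + 1) * r + (j + 1)\<close>, which are consecutive even across row ends, and
  \<open>QT\<close> through the transposed cells in steps of \<open>r\<close>. The digit of a pair
  sits at the cell with the smaller label first, hence the choice between \<open>Q\<close> and
  \<open>QT\<close>. \<open>W\<close> adds up only the pairs \<open>i < j\<close>,
  \<open>Row\<close> the whole row.\<close>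

definition build_sizes :: com where
  "build_sizes = (Const (fr OK) 1 ;; Const (fr W) 0 ;; Add (fr Q) (fr R) (fr Zero)) ;;
     for_upto I (fr R)
       ((Const (fr Row) 0 ;; Add (fr QT) (fr I) (fr One)) ;;
        for_upto J (fr R)
          (Add (fr Q) (fr Q) (fr One) ;; Add (fr QT) (fr QT) (fr R) ;;
           Sub (fr D) (fr J) (fr I) ;;
           IfNZ (fr D)
             (Load (fr D) (fr DigitA) (fr Q) ;; Add (fr W) (fr W) (fr D) ;;
              Add (fr Row) (fr Row) (fr D) ;; Store ''alpha'' (fr Q) (fr D))
             (Sub (fr D) (fr I) (fr J) ;;
              IfNZ (fr D)
                (Load (fr D) (fr DigitA) (fr QT) ;;
                 Add (fr Row) (fr Row) (fr D) ;; Store ''alpha'' (fr Q) (fr D))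
                Skip)) ;;
        Sub (fr D) (fr Row) (fr L) ;; IfNZ (fr D) (Const (fr OK) 0) Skip)"

definition restore_graph :: com where
  "restore_graph = (Add ''n'' (fr N) (fr Zero) ;; Add ''r'' (fr R) (fr Zero)) ;;
     for_upto I (fr NN) (Load (fr D) (fr GraphA) (fr I) ;; Store ''G'' (fr I) (fr D))"

text \<open>\<open>W\<close> turns from the weight into the slack. The cells for labels 1 and 2 in
  the table of \<open>\<alpha>\<close> are \<open>r + 2\<close> and
  \<open>2 * r + 1\<close>.\<close>

definition pad_instance :: com where
  "pad_instance = Sub (fr W) (fr RL) (fr W) ;;
     Load (fr D) ''G'' (fr I12) ;; Add (fr D) (fr D) (fr W) ;; Store ''G'' (fr I12) (fr D) ;;
     Load (fr D) ''G'' (fr I21) ;; Add (fr D) (fr D) (fr W) ;; Store ''G'' (fr I21) (fr D) ;;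
     Const (fr Q) 2 ;; Add (fr Q) (fr R) (fr Q) ;;
     Load (fr D) ''alpha'' (fr Q) ;; Add (fr D) (fr D) (fr W) ;; Store ''alpha'' (fr Q) (fr D) ;;
     Add (fr Q) (fr R) (fr R) ;; Add (fr Q) (fr Q) (fr One) ;;
     Load (fr D) ''alpha'' (fr Q) ;; Add (fr D) (fr D) (fr W) ;; Store ''alpha'' (fr Q) (fr D)"

text \<open>The two truncated differences add up to the distance between \<open>Lab\<close> and the
  current label, so \<open>D\<close> is 0 exactly on equality. \<open>Lab = 0\<close> means an
  unrestricted vertex.\<close>

definition write_lists :: com where
  "write_lists = Const (fr Q) 0 ;;
     for_upto I (fr N)
       (Load (fr Lab) (fr NumA) (fr I) ;;
        for_upto J (fr R)
          (Add (fr Q) (fr Q) (fr One) ;;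
           Add (fr QT) (fr J) (fr One) ;; Sub (fr D) (fr Lab) (fr QT) ;;
           Sub (fr QT) (fr QT) (fr Lab) ;; Add (fr D) (fr D) (fr QT) ;;
           IfNZ (fr Lab)
             (IfNZ (fr D) (Store ''lambda'' (fr Q) (fr Zero)) (Store ''lambda'' (fr Q) (fr One)))
             (Store ''lambda'' (fr Q) (fr One))))"

definition try_sizes :: com where
  "try_sizes = restore_graph ;; pad_instance ;; write_lists ;; P ;;
     IfNZ ''ans'' (Const (fr Found) 1 ;; Const (fr Go) 0) Skip"

text \<open>Scans for the lowest position that can be incremented. Digits passed over are cleared
  and taken off \<open>Tot\<close>, so at position \<open>p\<close> this register holds the sum from
  \<open>p\<close> on, as \<open>can_incr\<close> demands. After a success \<open>Cont = 0\<close>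
  makes the rest of the scan idle.\<close>

definition next_digits :: com where
  "next_digits = Const (fr Cont) 1 ;;
     for_upto I (fr M)
       (IfNZ (fr Cont)
         (Load (fr Lab) (fr DigitA) (fr I) ;; Sub (fr D) (fr L) (fr Lab) ;;
          Sub (fr QT) (fr RL) (fr Tot) ;;
          IfNZ (fr D)
            (IfNZ (fr QT)
              (Add (fr Lab) (fr Lab) (fr One) ;; Store (fr DigitA) (fr I) (fr Lab) ;;
               Add (fr Tot) (fr Tot) (fr One) ;; Const (fr Cont) 0)
              (Sub (fr Tot) (fr Tot) (fr Lab) ;; Store (fr DigitA) (fr I) (fr Zero)))
            (Sub (fr Tot) (fr Tot) (fr Lab) ;; Store (fr DigitA) (fr I) (fr Zero)))
         Skip) ;;
     IfNZ (fr Cont) (Const (fr Go) 0) Skip"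

definition search_body :: com where
  "search_body = build_sizes ;; IfNZ (fr OK) try_sizes Skip ;; IfNZ (fr Go) next_digits Skip"

definition prepare :: com where
  "prepare = init_regs ;; init_squares ;; init_products ;; save_graph ;; number_terminals ;;
     terminal_cells ;; init_digits"

definition search :: com where
  "search = prepare ;; WhileNZ (fr Go) search_body ;; Add ''ans'' (fr Found) (fr Zero)"

text \<open>With no terminals only the empty partition qualifies, and only for \<open>n = 0\<close>.
  One terminal admits the single class of all vertices, which has no boundary.\<close>

definition multiway_cut_program :: com where
  "multiway_cut_program =
     IfNZ ''r''
       ((Const (fr One) 1 ;; Sub (fr D) ''r'' (fr One)) ;;
        IfNZ (fr D) search
          (for_upto I ''n'' (Store ''out'' (fr I) (fr One)) ;; Const ''ans'' 1))
       (IfNZ ''n'' (Const ''ans'' 0) (Const ''ans'' 1))"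

end

section \<open>Correctness of the search\<close>

definition rank :: "nat set \<Rightarrow> nat \<Rightarrow> nat" where
  "rank X v = card {u \<in> X. u \<le> v}"

lemma rank_less: "finite X \<Longrightarrow> v \<in> X \<Longrightarrow> u < v \<Longrightarrow> rank X u < rank X v"
  unfolding rank_def by (intro psubset_card_mono psubsetI) (auto simp: set_eq_iff intro!: exI[of _ v])

lemma bij_betw_rank:
  assumes "finite X"
  shows "bij_betw (rank X) X {1..card X}"
proof -
  have inj: "inj_on (rank X) X"
    by (rule inj_onI) (metis assms rank_less less_irrefl linorder_neqE_nat)
  have "rank X v \<in> {1..card X}" if "v \<in> X" for v
    using assms that card_gt_0_iff[of "{u \<in> X. u \<le> v}"]
    by (auto simp: rank_def Suc_le_eq intro: card_mono)
  then have "rank X ` X \<subseteq> {1..card X}" by blast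
  then have "rank X ` X = {1..card X}"
    using inj by (intro card_subset_eq) (auto simp: card_image)
  then show ?thesis using inj by (simp add: bij_betw_def)
qed

text \<open>The cell of the pair \<open>(u, i + 1)\<close> in a table with rows of \<open>r\<close> labels \<open>1, \<dots>, r\<close>.\<close>

definition cell :: "nat \<Rightarrow> nat \<Rightarrow> nat \<Rightarrow> nat" where
  "cell r u i = u * r + Suc i"

lemma cell_inj: "i < r \<Longrightarrow> i' < r \<Longrightarrow> cell r u i = cell r u' i' \<longleftrightarrow> u = u' \<and> i = i'"
  using row_major_inj[of i r i' u u'] by (auto simp: cell_def)

lemma cell_less: "i < r \<Longrightarrow> j < r \<Longrightarrow> cell r (Suc i) j < num_digits r"
  using row_major_less[of i r j r] by (simp add: cell_def num_digits_def)

text \<open>Turns a sum over labels into one over loop counters, with a zero summand for the missing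
  label, as the inner loop of \<open>build_sizes\<close> accumulates it.\<close>

lemma sum_drop_one:
  fixes f :: "nat \<Rightarrow> nat"
  assumes "i < r"
  shows "(\<Sum>j\<in>{1..r} - {Suc i}. f j) = (\<Sum>j<r. if j = i then 0 else f (Suc j))"
proof -
  have "(\<Sum>j\<in>{1..r} - {Suc i}. f j) = (\<Sum>j\<in>{1..r} - {Suc i}. if j = Suc i then 0 else f j)"
    by (intro sum.cong) auto
  also have "\<dots> = (\<Sum>j\<in>{1..r}. if j = Suc i then 0 else f j)"
    by (intro sum.mono_neutral_left) auto
  also have "\<dots> = (\<Sum>j<r. if Suc j = Suc i then 0 else f (Suc j))"
    by (simp only: One_nat_def sum.atLeast1_atMost_eq)
  finally show ?thesis by simp
qed

lemma sum_above:
  fixes f :: "nat \<Rightarrow> nat"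
  shows "(\<Sum>j\<in>{Suc i<..r}. f j) = (\<Sum>j<r. if i < j then f (Suc j) else 0)"
proof -
  have "(\<Sum>j\<in>{Suc i<..r}. f j) = (\<Sum>j\<in>{Suc i<..r}. if Suc i < j then f j else 0)"
    by (intro sum.cong) auto
  also have "\<dots> = (\<Sum>j\<in>{1..r}. if Suc i < j then f j else 0)"
    by (intro sum.mono_neutral_left) auto
  also have "\<dots> = (\<Sum>j<r. if Suc i < Suc j then f (Suc j) else 0)"
    by (simp only: One_nat_def sum.atLeast1_atMost_eq)
  finally show ?thesis by simp
qed

locale search_instance = program P fr for P fr +
  fixes G :: "(nat, nat) mgraph" and n l r :: nat and X :: "nat set" and T :: "nat \<Rightarrow> nat \<Rightarrow> real"
  assumes solver: "solves_list_allocation P T"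
    and inst': "mmc_instance G r X" and r': "2 \<le> r" and vs: "verts G = {..<n}"
begin

definition t1 :: nat where "t1 = inv_into X (rank X) 1"
definition t2 :: nat where "t2 = inv_into X (rank X) 2"

sublocale padded_terminals G r X "rank X" l t1 t2
proof -
  have "finite X" "card X = r"
    using inst' finite_subset by (auto simp: mmc_instance_def wf_mgraph_def)
  then have bij: "bij_betw (rank X) X {1..r}" using bij_betw_rank by blast
  have "inv_into X (rank X) i \<in> X \<and> rank X (inv_into X (rank X) i) = i" if "i \<in> {1..r}" for i
    using bij that unfolding bij_betw_def by (metis inv_into_into f_inv_into_f)
  then show "padded_terminals G r X (rank X) t1 t2"
    using inst' r' bij unfolding t1_def t2_def by unfold_locales auto
qed

lemma n: "r \<le> n" "card (verts G) = n"
  using wf vs card_mono[of "{..<n}" X] by auto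

section \<open>Preparation up to the first guess\<close>

definition mult :: "nat \<Rightarrow> nat" where
  "mult p = card (delta G {p div n} {p mod n})"

text \<open>The \<open>setup\<close> predicates form a chain that grows with the phases of the
  preparation. They mention only working names, so the last one survives every solver call.\<close>

definition setup_regs :: "state \<Rightarrow> bool" where
  "setup_regs s \<longleftrightarrow> regs s (fr Zero) = 0 \<and> regs s (fr One) = 1 \<and>
     regs s (fr N) = n \<and> regs s (fr R) = r \<and> regs s (fr L) = l"

definition setup_sizes :: "state \<Rightarrow> bool" where
  "setup_sizes s \<longleftrightarrow> setup_regs s \<and> regs s (fr NN) = n * n \<and> regs s (fr RL) = r * l \<and>
     regs s (fr M) = num_digits r"

definition setup_graph :: "state \<Rightarrow> bool" where
  "setup_graph s \<longleftrightarrow> setup_sizes s \<and> (\<forall>p<n * n. arrs s (fr GraphA) p = mult p)"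

definition setup_done :: "state \<Rightarrow> bool" where
  "setup_done s \<longleftrightarrow> setup_graph s \<and>
     (\<forall>v<n. arrs s (fr NumA) v = (if v \<in> X then rank X v else 0)) \<and>
     regs s (fr I12) = t1 * n + t2 \<and> regs s (fr I21) = t2 * n + t1"

lemmas setup_defs = setup_regs_def setup_sizes_def setup_graph_def setup_done_def

lemma mult_input:
  assumes "enc_mmc G l r X s" "p < n * n"
  shows "arrs s ''G'' p = mult p"
proof -
  have "p div n < n" "p mod n < n"
    using assms(2) by (auto simp: less_mult_imp_div_less mult_0_right intro!: mod_less_divisor gr0I)
  moreover have "\<forall>u<n. \<forall>v<n. arrs s ''G'' (u * n + v) = card (delta G {u} {v})"
    using assms(1) n(2) by (simp add: enc_mmc_def enc_graph_def Let_def)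
  ultimately have "arrs s ''G'' (p div n * n + p mod n) = mult p"
    by (simp only: mult_def)
  then show ?thesis by simp
qed

text \<open>Writes to working names leave the input intact. As rewrite rules these equations
  discharge the input part of the invariants of the preparation.\<close>

lemma enc_mmc_fr [simp]:
  "enc_mmc G l r X (s\<lparr>regs := f(fr x := a)\<rparr>) = enc_mmc G l r X (s\<lparr>regs := f\<rparr>)"
  "enc_mmc G l r X (s\<lparr>arrs := g(fr x := b)\<rparr>) = enc_mmc G l r X (s\<lparr>arrs := g\<rparr>)"
  "enc_mmc G l r X (s\<lparr>regs := f, arrs := g(fr x := b)\<rparr>) = enc_mmc G l r X (s\<lparr>regs := f, arrs := g\<rparr>)"
  "enc_mmc G l r X (s\<lparr>regs := f(fr x := a), arrs := g\<rparr>) = enc_mmc G l r X (s\<lparr>regs := f, arrs := g\<rparr>)"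
  by (auto simp: enc_mmc_def enc_graph_def Let_def)

lemma update_same [simp]: "s\<lparr>regs := regs s\<rparr> = s" "s\<lparr>arrs := arrs s\<rparr> = s"
  "s\<lparr>regs := f, arrs := arrs s\<rparr> = s\<lparr>regs := f\<rparr>"
  by (cases s; simp)+

abbreviation enc :: "state \<Rightarrow> bool" where "enc \<equiv> enc_mmc G l r X"

lemma enc_input:
  "enc s \<Longrightarrow> regs s ''n'' = n" "enc s \<Longrightarrow> regs s ''r'' = r" "enc s \<Longrightarrow> regs s ''l'' = l"
  "enc s \<Longrightarrow> v < n \<Longrightarrow> arrs s ''T'' v = (if v \<in> X then 1 else 0)"
  using n by (simp_all add: enc_mmc_def enc_graph_def Let_def vs)

lemma init_regs_triple:
  "triple enc init_regs 8
    (\<lambda>s. enc s \<and> setup_regs s \<and> regs s (fr NN) = 0 \<and> regs s (fr RL) = 0 \<and> regs s (fr M) = 1)"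
  unfolding init_regs_def by (rule triple_run) (simp_all add: setup_defs enc_input)


lemma init_squares_triple:
  "triple (\<lambda>s. enc s \<and> setup_regs s \<and> regs s (fr NN) = 0 \<and> regs s (fr RL) = 0 \<and> regs s (fr M) = 1)
    init_squares (n * 5 + 3)
    (\<lambda>s. enc s \<and> setup_regs s \<and> regs s (fr NN) = n * n \<and> regs s (fr RL) = 0 \<and> regs s (fr M) = 1)"
proof -
  let ?I = "\<lambda>i s. enc s \<and> setup_regs s \<and> regs s (fr NN) = i * n \<and> regs s (fr RL) = 0 \<and> regs s (fr M) = 1"
  have "triple (?I 0) init_squares (n * (1 + 4) + 3) (?I n)"
    unfolding init_squares_def
    by (rule triple_for_loop[where I = ?I]; (rule triple_run)?; simp add: setup_defs)
  then show ?thesis by simp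
qed

lemma init_products_triple:
  "triple (\<lambda>s. enc s \<and> setup_regs s \<and> regs s (fr NN) = n * n \<and> regs s (fr RL) = 0 \<and> regs s (fr M) = 1)
    init_products (r * 6 + 4) (\<lambda>s. enc s \<and> setup_sizes s)"
proof -
  let ?I = "\<lambda>i s. enc s \<and> setup_regs s \<and> regs s (fr NN) = n * n \<and> regs s (fr RL) = i * l \<and>
    regs s (fr M) = i * r + 1"
  have 1: "triple (?I 0) (for_upto I (fr R) (Add (fr RL) (fr RL) (fr L) ;; Add (fr M) (fr M) (fr R)))
      (r * (2 + 4) + 3) (?I r)"
    by (rule triple_for_loop[where I = ?I]; (rule triple_run)?; simp add: setup_defs)
  have 2: "triple (?I r) (Add (fr M) (fr M) (fr R)) 1 (\<lambda>s. enc s \<and> setup_sizes s)"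
    by (rule triple_run; simp add: setup_defs num_digits_def)
  show ?thesis
    unfolding init_products_def by (rule triple_conseq[OF triple_Seq[OF 1 2]]) auto
qed

lemma save_graph_triple:
  "triple (\<lambda>s. enc s \<and> setup_sizes s) save_graph (n * n * 6 + 3) (\<lambda>s. enc s \<and> setup_graph s)"
proof -
  let ?I = "\<lambda>i s. enc s \<and> setup_sizes s \<and> (\<forall>p<i. arrs s (fr GraphA) p = mult p)"
  have "triple (\<lambda>s. enc s \<and> setup_sizes s) save_graph (n * n * (2 + 4) + 3) (?I (n * n))"
    unfolding save_graph_def
    by (rule triple_for_loop[where I = ?I]; (rule triple_run)?;
        simp add: setup_defs mult_input less_Suc_eq)
  then show ?thesis by (simp add: setup_graph_def)
qed

lemma number_terminals_triple:
  "triple (\<lambda>s. enc s \<and> setup_graph s) number_terminals (n * 11 + 5)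
    (\<lambda>s. setup_graph s \<and> (\<forall>v<n. arrs s (fr NumA) v = (if v \<in> X then rank X v else 0)) \<and>
      (\<forall>v\<in>X. arrs s (fr TermA) (rank X v) = v \<and> arrs s (fr TermBaseA) (rank X v) = v * n))"
proof -
  define count where "count v = card {u \<in> X. u < v}" for v
  let ?I = "\<lambda>i s. enc s \<and> setup_graph s \<and> regs s (fr Cnt) = count i \<and> regs s (fr Base) = i * n \<and>
    (\<forall>v<i. arrs s (fr NumA) v = (if v \<in> X then rank X v else 0)) \<and>
    (\<forall>v\<in>X. v < i \<longrightarrow> arrs s (fr TermA) (rank X v) = v \<and> arrs s (fr TermBaseA) (rank X v) = v * n)"
  have "{u \<in> X. u < Suc v} = (if v \<in> X then insert v {u \<in> X. u < v} else {u \<in> X. u < v})" for v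
    by (auto simp: less_Suc_eq)
  then have count_Suc: "count (Suc v) = (if v \<in> X then Suc (count v) else count v)" for v
    using wf(3) by (simp add: count_def)
  have rank: "v \<in> X \<Longrightarrow> rank X v = Suc (count v)" for v
    using count_Suc[of v] by (simp add: rank_def count_def less_Suc_eq_le)
  \<comment> \<open>Distinct terminals have distinct ranks, so a new entry of \<open>TermA\<close>
    or \<open>TermBaseA\<close> overwrites no earlier one.\<close>
  have count_neq: "v \<in> X \<Longrightarrow> u \<in> X \<Longrightarrow> count u = count v \<Longrightarrow> \<not> u < v" for u v
    using rank_less[OF wf(3), of v u] rank[of v] rank[of u] by auto
  have 1: "triple (\<lambda>s. enc s \<and> setup_graph s) (Const (fr Cnt) 0 ;; Const (fr Base) 0) 2 (?I 0)"
    by (rule triple_run; simp add: setup_defs count_def)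
  have 2: "triple (?I 0)
     (for_upto I (fr N)
       (Load (fr D) ''T'' (fr I) ;;
        IfNZ (fr D)
          (Add (fr Cnt) (fr Cnt) (fr One) ;; Store (fr NumA) (fr I) (fr Cnt) ;;
           Store (fr TermA) (fr Cnt) (fr I) ;; Store (fr TermBaseA) (fr Cnt) (fr Base))
          (Store (fr NumA) (fr I) (fr Zero)) ;;
        Add (fr Base) (fr Base) (fr N))) (n * (7 + 4) + 3) (?I n)"
  proof (rule triple_for_loop[where I = ?I], goal_cases)
    case (5 i)
    show ?case
    proof (rule triple_run, goal_cases)
      case (2 s)
      then show ?case
        using 5
        by (cases "i \<in> X")
          (simp_all add: setup_defs enc_input count_Suc rank count_neq less_Suc_eq all_conj_distrib)
    qed simp_all
  qed (simp_all add: setup_defs)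
  have X: "v < n" if "v \<in> X" for v using that wf(2) vs by auto
  show ?thesis
    unfolding number_terminals_def
    by (rule triple_conseq[OF triple_Seq[OF 1 2]]) (use X in auto)
qed

lemma terminal_cells_triple:
  "triple (\<lambda>s. setup_graph s \<and> (\<forall>v<n. arrs s (fr NumA) v = (if v \<in> X then rank X v else 0)) \<and>
      (\<forall>v\<in>X. arrs s (fr TermA) (rank X v) = v \<and> arrs s (fr TermBaseA) (rank X v) = v * n))
    terminal_cells 7 setup_done"
  unfolding terminal_cells_def
proof (rule triple_run, goal_cases)
  case (2 s)
  then have "arrs s (fr TermA) 1 = t1" "arrs s (fr TermBaseA) 1 = t1 * n"
    "arrs s (fr TermA) 2 = t2" "arrs s (fr TermBaseA) 2 = t2 * n"
    using t1 t2 by metis+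
  with 2 show ?case by (simp add: setup_defs)
qed simp_all

text \<open>What persists from round to round while the search is undecided. The input encoding is
  deliberately absent, since the solver may have destroyed it.\<close>

definition working :: "(nat \<Rightarrow> nat) \<Rightarrow> state \<Rightarrow> bool" where
  "working a s \<longleftrightarrow> setup_done s \<and> (\<forall>p<num_digits r. arrs s (fr DigitA) p = a p) \<and>
     regs s (fr Tot) = (\<Sum>p<num_digits r. a p) \<and> regs s (fr Found) = 0 \<and> regs s (fr Go) = 1"

lemma init_digits_triple:
  "triple setup_done init_digits (num_digits r * 5 + 6) (working (\<lambda>_. 0))"
proof -
  let ?I = "\<lambda>i s. setup_done s \<and> (\<forall>p<i. arrs s (fr DigitA) p = 0)"
  have 1: "triple setup_done (for_upto I (fr M) (Store (fr DigitA) (fr I) (fr Zero)))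
      (num_digits r * (1 + 4) + 3) (?I (num_digits r))"
    by (rule triple_for_loop[where I = ?I]; (rule triple_run)?; simp add: setup_defs less_Suc_eq)
  have 2: "triple (?I (num_digits r)) (Const (fr Tot) 0 ;; Const (fr Found) 0 ;; Const (fr Go) 1) 3
      (working (\<lambda>_. 0))"
    by (rule triple_run; simp add: setup_defs working_def)
  show ?thesis
    unfolding init_digits_def by (rule triple_conseq[OF triple_Seq[OF 1 2]]) auto
qed

text \<open>Every phase is at most quadratic in \<open>n\<close> because \<open>r \<le> n\<close>;
  100 generously bounds the sum of all coefficients.\<close>

lemma prepare_triple:
  "triple enc prepare (100 * (n * n)) (working (\<lambda>_. 0))"
proof -
  have "1 \<le> n" "n \<le> n * n" "1 \<le> n * n" "r \<le> n * n" "r * r \<le> n * n"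
    using n(1) r' by (auto intro: mult_le_mono order_trans[OF n(1)])
  then have "8 + ((n * 5 + 3) + ((r * 6 + 4) + ((n * n * 6 + 3) + ((n * 11 + 5) + (7 +
      (num_digits r * 5 + 6)))))) \<le> 100 * (n * n)"
    unfolding num_digits_def add_mult_distrib by linarith
  then show ?thesis
    unfolding prepare_def
    by (intro triple_conseq[OF triple_Seq[OF init_regs_triple triple_Seq[OF init_squares_triple
      triple_Seq[OF init_products_triple triple_Seq[OF save_graph_triple
      triple_Seq[OF number_terminals_triple triple_Seq[OF terminal_cells_triple
      init_digits_triple]]]]]]])
qed


section \<open>Writing the cut sizes of a guess\<close>

context
  fixes a :: "nat \<Rightarrow> nat"
begin

abbreviation size_of :: "nat \<Rightarrow> nat \<Rightarrow> nat" where
  "size_of i j \<equiv> cut_size r a {Suc i, Suc j}"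

definition row_sum :: "nat \<Rightarrow> nat \<Rightarrow> nat" where
  "row_sum i j = (\<Sum>j'<j. if j' = i then 0 else size_of i j')"

definition upper_sum :: "nat \<Rightarrow> nat \<Rightarrow> nat" where
  "upper_sum i j = (\<Sum>j'<j. if i < j' then size_of i j' else 0)"

definition sizes_written :: "nat \<Rightarrow> nat \<Rightarrow> (nat \<Rightarrow> nat) \<Rightarrow> bool" where
  "sizes_written i j f \<longleftrightarrow> (\<forall>i' j'. i' < r \<longrightarrow> j' < r \<longrightarrow> i' \<noteq> j' \<longrightarrow>
     (i' < i \<or> i' = i \<and> j' < j) \<longrightarrow> f (cell r (Suc i') j') = size_of i' j')"

lemma row_sum_rec [simp]:
  "row_sum i 0 = 0" "row_sum i (Suc j) = row_sum i j + (if j = i then 0 else size_of i j)"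
  by (simp_all add: row_sum_def)

lemma upper_sum_rec [simp]:
  "upper_sum i 0 = 0" "upper_sum i (Suc j) = upper_sum i j + (if i < j then size_of i j else 0)"
  by (simp_all add: upper_sum_def)

lemma sizes_written_0: "sizes_written 0 0 f"
  by (simp add: sizes_written_def)

lemma sizes_written_store:
  "sizes_written i j f \<Longrightarrow> i < r \<Longrightarrow> j < r \<Longrightarrow>
    sizes_written i (Suc j) (f(cell r (Suc i) j := size_of i j))"
  unfolding sizes_written_def by (auto simp: cell_inj less_Suc_eq)

lemma sizes_written_skip: "sizes_written i i f \<Longrightarrow> sizes_written i (Suc i) f"
  by (auto simp: sizes_written_def less_Suc_eq)

lemma sizes_written_row: "sizes_written i r f \<Longrightarrow> sizes_written (Suc i) 0 f"
  by (auto simp: sizes_written_def less_Suc_eq)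

lemma row_ok_iff: "row_ok r l a \<longleftrightarrow> (\<forall>i<r. row_sum i r \<le> l)"
proof -
  have "row_ok r l a \<longleftrightarrow> (\<forall>i<r. (\<Sum>j\<in>{1..r} - {Suc i}. cut_size r a {Suc i, j}) \<le> l)"
  proof
    assume "\<forall>i<r. (\<Sum>j\<in>{1..r} - {Suc i}. cut_size r a {Suc i, j}) \<le> l"
    then have "(\<Sum>j\<in>{1..r} - {i}. cut_size r a {i, j}) \<le> l" if "i \<in> {1..r}" for i
      using that by (cases i) (auto simp: Suc_le_eq simp del: One_nat_def)
    then show "row_ok r l a" by (simp add: row_ok_def)
  qed (simp add: row_ok_def)
  then show ?thesis by (simp add: row_sum_def sum_drop_one del: One_nat_def)
qed

lemma weight_eq: "la_weight r (cut_size r a) = (\<Sum>i<r. upper_sum i r)"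
  unfolding la_weight_eq by (simp add: sum.atLeast1_atMost_eq sum_above upper_sum_def)

text \<open>Moves through the table by increments. Rows join without a gap: the cell after the last
  label of a row is the first cell of the next row.\<close>

lemma cell_Suc [simp]: "Suc (cell r u i) = cell r u (Suc i)" "cell r u r = cell r (Suc u) 0"
  "cell r u i + r = cell r (Suc u) i"
  by (simp_all add: cell_def)

lemma size_of_less: "i < j \<Longrightarrow> size_of i j = a (cell r (Suc i) j)"
  and size_of_greater: "j < i \<Longrightarrow> size_of i j = a (cell r (Suc j) i)"
  using cut_size_pair[of "Suc i" "Suc j" r a] cut_size_pair[of "Suc j" "Suc i" r a]
  by (simp_all add: cell_def insert_commute)

lemma build_sizes_triple:
  "triple (working a) build_sizes (r * (r * 14 + 12) + 6)
    (\<lambda>s. working a s \<and> sizes_written r 0 (arrs s ''alpha'') \<and>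
      regs s (fr W) = la_weight r (cut_size r a) \<and>
      regs s (fr OK) = (if row_ok r l a then 1 else 0))"
proof -
  let ?O = "\<lambda>i s. working a s \<and> sizes_written i 0 (arrs s ''alpha'') \<and>
    Suc (regs s (fr Q)) = cell r (Suc i) 0 \<and>
    regs s (fr W) = (\<Sum>i'<i. upper_sum i' r) \<and>
    regs s (fr OK) = (if \<forall>i'<i. row_sum i' r \<le> l then 1 else 0)"
  \<comment> \<open>\<open>Q\<close> and \<open>QT\<close> are advanced before they are used, hence
    the invariant speaks of \<open>Suc\<close> and of \<open>+ r\<close>.\<close>
  let ?J = "\<lambda>i j s. working a s \<and> sizes_written i j (arrs s ''alpha'') \<and> regs s (fr I) = i \<and>
    Suc (regs s (fr Q)) = cell r (Suc i) j \<and> regs s (fr QT) + r = cell r (Suc j) i \<and>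
    regs s (fr W) = (\<Sum>i'<i. upper_sum i' r) + upper_sum i j \<and> regs s (fr Row) = row_sum i j \<and>
    regs s (fr OK) = (if \<forall>i'<i. row_sum i' r \<le> l then 1 else 0)"
  note defs = working_def setup_defs
  let ?c1 = "Const (fr OK) 1 ;; Const (fr W) 0 ;; Add (fr Q) (fr R) (fr Zero)"
  let ?c2 = "Const (fr Row) 0 ;; Add (fr QT) (fr I) (fr One)"
  let ?c3 = "Add (fr Q) (fr Q) (fr One) ;; Add (fr QT) (fr QT) (fr R) ;;
           Sub (fr D) (fr J) (fr I) ;;
           IfNZ (fr D)
             (Load (fr D) (fr DigitA) (fr Q) ;; Add (fr W) (fr W) (fr D) ;;
              Add (fr Row) (fr Row) (fr D) ;; Store ''alpha'' (fr Q) (fr D))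
             (Sub (fr D) (fr I) (fr J) ;;
              IfNZ (fr D)
                (Load (fr D) (fr DigitA) (fr QT) ;;
                 Add (fr Row) (fr Row) (fr D) ;; Store ''alpha'' (fr Q) (fr D))
                Skip)"
  let ?c4 = "Sub (fr D) (fr Row) (fr L) ;; IfNZ (fr D) (Const (fr OK) 0) Skip"
  have 1: "triple (working a) ?c1 3 (?O 0)"
    by (rule triple_run; simp add: defs sizes_written_0) (simp add: cell_def)
  have 2: "triple (\<lambda>s. ?O i s \<and> regs s (fr I) = i) ?c2 2 (?J i 0)" for i
    by (rule triple_run; simp add: defs) (simp add: cell_def)
  have body: "triple (\<lambda>s. ?J i j s \<and> regs s (fr J) = j) ?c3 10 (\<lambda>s. ?J i (Suc j) s \<and> regs s (fr J) = j)"
    if "i < r" "j < r" for i j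
  proof (rule triple_run, goal_cases)
    case (2 s)
    have cells: "cell r (Suc i) j < num_digits r" "cell r (Suc j) i < num_digits r"
      using that by (simp_all add: cell_less)
    consider "i < j" | "j < i" | "i = j" by linarith
    then show ?case
    proof cases
      case 1
      then show ?thesis
        using 2 that cells sizes_written_store[of i j "arrs s ''alpha''"]
        by (simp add: defs size_of_less)
    next
      case gt: 2
      then show ?thesis
        using 2 that cells sizes_written_store[of i j "arrs s ''alpha''"]
        by (simp add: defs size_of_greater)
    next
      case 3
      then show ?thesis
        using 2 sizes_written_skip[of i "arrs s ''alpha''"] by (simp add: defs)
    qed
  qed simp_all
  have 3: "triple (?J i 0) (for_upto J (fr R) ?c3) (r * (10 + 4) + 3) (?J i r)" if "i < r" for i
    by (rule triple_for_loop[where I = "?J i"]; (rule body[OF that])?; simp add: defs)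
  have 4: "triple (?J i r) ?c4 3 (\<lambda>s. ?O (Suc i) s \<and> regs s (fr I) = i)" if "i < r" for i
  proof (rule triple_run, goal_cases)
    case (2 s)
    then show ?case
      using sizes_written_row[of i "arrs s ''alpha''"] by (auto simp: defs less_Suc_eq)
  qed simp_all
  have 5: "triple (\<lambda>s. ?O i s \<and> regs s (fr I) = i) (?c2 ;; for_upto J (fr R) ?c3 ;; ?c4) (r * 14 + 8)
      (\<lambda>s. ?O (Suc i) s \<and> regs s (fr I) = i)" if "i < r" for i
    by (rule triple_conseq[OF triple_Seq[OF 2 triple_Seq[OF 3[OF that] 4[OF that]]]]) simp_all
  have 6: "triple (?O 0) (for_upto I (fr R) (?c2 ;; for_upto J (fr R) ?c3 ;; ?c4))
      (r * (r * 14 + 8 + 4) + 3) (?O r)"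
    by (rule triple_for_loop[where I = ?O]; (rule 5)?; simp add: defs)
  show ?thesis
    unfolding build_sizes_def
    by (rule triple_conseq[OF triple_Seq[OF 1 6]]) (simp_all add: row_ok_iff weight_eq)
qed

end


section \<open>Assembling the padded instance and calling the solver\<close>

definition lists_written :: "nat \<Rightarrow> nat \<Rightarrow> (nat \<Rightarrow> nat) \<Rightarrow> bool" where
  "lists_written v i f \<longleftrightarrow> (\<forall>u i'. i' < r \<longrightarrow> (u < v \<or> u = v \<and> i' < i) \<longrightarrow>
     f (cell r u i') = (if Suc i' \<in> lists u then 1 else 0))"

lemma lists_written_0: "lists_written 0 0 f"
  by (simp add: lists_written_def)

lemma lists_written_store:
  "lists_written v i f \<Longrightarrow> i < r \<Longrightarrow> x = (if Suc i \<in> lists v then 1 else 0) \<Longrightarrow>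
    lists_written v (Suc i) (f(cell r v i := x))"
  unfolding lists_written_def by (auto simp: cell_inj less_Suc_eq)

lemma lists_written_row: "lists_written v r f \<Longrightarrow> lists_written (Suc v) 0 f"
  by (auto simp: lists_written_def less_Suc_eq)

definition padded_written :: "(nat \<Rightarrow> nat) \<Rightarrow> state \<Rightarrow> bool" where
  "padded_written a s \<longleftrightarrow> regs s ''n'' = n \<and> regs s ''r'' = r \<and>
     (\<forall>p<n * n. arrs s ''G'' p =
        mult p + (if p = t1 * n + t2 \<or> p = t2 * n + t1 then slack a else 0)) \<and>
     (\<forall>i<r. \<forall>j<r. i \<noteq> j \<longrightarrow> arrs s ''alpha'' (cell r (Suc i) j) = padded_size a {Suc i, Suc j})"

lemma terminals_less: "t1 < n" "t2 < n"
  using t1 t2 wf(2) vs by auto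

lemma restore_graph_triple:
  "triple (\<lambda>s. working a s \<and> sizes_written a r 0 (arrs s ''alpha'') \<and>
      regs s (fr W) = la_weight r (cut_size r a))
    restore_graph (n * n * 6 + 5)
    (\<lambda>s. working a s \<and> sizes_written a r 0 (arrs s ''alpha'') \<and>
      regs s (fr W) = la_weight r (cut_size r a) \<and> regs s ''n'' = n \<and> regs s ''r'' = r \<and>
      (\<forall>p<n * n. arrs s ''G'' p = mult p))"
proof -
  let ?I = "\<lambda>i s. working a s \<and> sizes_written a r 0 (arrs s ''alpha'') \<and>
      regs s (fr W) = la_weight r (cut_size r a) \<and> regs s ''n'' = n \<and> regs s ''r'' = r \<and>
      (\<forall>p<i. arrs s ''G'' p = mult p)"
  have 1: "triple (\<lambda>s. working a s \<and> sizes_written a r 0 (arrs s ''alpha'') \<and>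
      regs s (fr W) = la_weight r (cut_size r a))
    (Add ''n'' (fr N) (fr Zero) ;; Add ''r'' (fr R) (fr Zero)) 2 (?I 0)"
    by (rule triple_run; simp add: working_def setup_defs)
  have 2: "triple (?I 0)
      (for_upto I (fr NN) (Load (fr D) (fr GraphA) (fr I) ;; Store ''G'' (fr I) (fr D)))
      (n * n * (2 + 4) + 3) (?I (n * n))"
    by (rule triple_for_loop[where I = ?I]; (rule triple_run)?;
        simp add: working_def setup_defs less_Suc_eq)
  show ?thesis
    unfolding restore_graph_def by (rule triple_conseq[OF triple_Seq[OF 1 2]]) simp_all
qed

lemma pad_instance_triple:
  "triple (\<lambda>s. working a s \<and> sizes_written a r 0 (arrs s ''alpha'') \<and>
      regs s (fr W) = la_weight r (cut_size r a) \<and> regs s ''n'' = n \<and> regs s ''r'' = r \<and>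
      (\<forall>p<n * n. arrs s ''G'' p = mult p))
    pad_instance 17 (\<lambda>s. working a s \<and> padded_written a s)"
proof (rule triple_run, goal_cases)
  case (2 s)
  let ?p = "t1 * n + t2" and ?q = "t2 * n + t1" and ?s = "run pad_instance s"
  let ?c = "cell r (Suc 0) (Suc 0)" and ?d = "cell r (Suc (Suc 0)) 0"
  \<comment> \<open>The two matrix cells differ, so each receives the slack exactly once.\<close>
  have pq: "?p \<noteq> ?q" "?q \<noteq> ?p" "?p < n * n" "?q < n * n"
    using terminals_less terminals_distinct by (auto simp: row_major_inj row_major_less)
  have c: "Suc (Suc r) = ?c" "Suc (r + r) = ?d"
    by (simp_all add: cell_def)
  have cd: "?c \<noteq> ?d" "?d \<noteq> ?c"
    using r' by (simp_all add: cell_inj)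
  have "working a ?s" "regs ?s ''n'' = n" "regs ?s ''r'' = r"
    using 2 by (simp_all add: pad_instance_def working_def setup_defs)
  moreover have "arrs ?s ''G'' =
      (arrs s ''G'')(?p := arrs s ''G'' ?p + slack a, ?q := arrs s ''G'' ?q + slack a)"
    using 2 pq by (simp add: pad_instance_def working_def setup_defs slack_def)
  then have "arrs ?s ''G'' p = mult p + (if p = ?p \<or> p = ?q then slack a else 0)" if "p < n * n" for p
    using 2 pq that by simp
  moreover have "arrs ?s ''alpha'' =
      (arrs s ''alpha'')(?c := arrs s ''alpha'' ?c + slack a, ?d := arrs s ''alpha'' ?d + slack a)"
    using 2 cd by (simp add: pad_instance_def working_def setup_defs slack_def c del: cell_Suc)
  then have "arrs ?s ''alpha'' (cell r (Suc i) j) = padded_size a {Suc i, Suc j}"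
    if "i < r" "j < r" "i \<noteq> j" for i j
  proof -
    have "arrs s ''alpha'' (cell r (Suc i) j) = cut_size r a {Suc i, Suc j}"
      using 2 that by (simp add: sizes_written_def)
    moreover have "{Suc i, Suc j} = {1, 2} \<longleftrightarrow> i = 0 \<and> j = 1 \<or> i = 1 \<and> j = 0"
      by (auto simp: doubleton_eq_iff)
    moreover have "cell r (Suc i) j = ?c \<longleftrightarrow> i = 0 \<and> j = 1"
      "cell r (Suc i) j = ?d \<longleftrightarrow> i = 1 \<and> j = 0"
      using that r' by (simp_all add: cell_inj)
    ultimately show ?thesis
      using \<open>arrs ?s ''alpha'' = _\<close> unfolding padded_size_def by (simp del: cell_Suc) metis
  qed
  ultimately show ?case by (simp add: padded_written_def)
qed (simp_all add: pad_instance_def)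

lemma write_lists_triple:
  "triple (\<lambda>s. working a s \<and> padded_written a s) write_lists (n * (r * 12 + 8) + 4)
    (\<lambda>s. working a s \<and> padded_written a s \<and> lists_written n 0 (arrs s ''lambda''))"
proof -
  let ?O = "\<lambda>v s. working a s \<and> padded_written a s \<and> lists_written v 0 (arrs s ''lambda'') \<and>
    Suc (regs s (fr Q)) = cell r v 0"
  let ?J = "\<lambda>v i s. working a s \<and> padded_written a s \<and> lists_written v i (arrs s ''lambda'') \<and>
    Suc (regs s (fr Q)) = cell r v i \<and> regs s (fr I) = v \<and>
    regs s (fr Lab) = (if v \<in> X then rank X v else 0)"
  note defs = working_def setup_defs padded_written_def
  let ?c = "Add (fr Q) (fr Q) (fr One) ;;
           Add (fr QT) (fr J) (fr One) ;; Sub (fr D) (fr Lab) (fr QT) ;;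
           Sub (fr QT) (fr QT) (fr Lab) ;; Add (fr D) (fr D) (fr QT) ;;
           IfNZ (fr Lab)
             (IfNZ (fr D) (Store ''lambda'' (fr Q) (fr Zero)) (Store ''lambda'' (fr Q) (fr One)))
             (Store ''lambda'' (fr Q) (fr One))"
  have 1: "triple (\<lambda>s. working a s \<and> padded_written a s) (Const (fr Q) 0) 1 (?O 0)"
    by (rule triple_run; simp add: defs lists_written_0) (simp add: cell_def)
  have 2: "triple (\<lambda>s. ?O v s \<and> regs s (fr I) = v) (Load (fr Lab) (fr NumA) (fr I)) 1 (?J v 0)"
    if "v < n" for v
    by (rule triple_run) (use that in \<open>simp_all add: defs\<close>)
  have body: "triple (\<lambda>s. ?J v i s \<and> regs s (fr J) = i) ?c 8 (\<lambda>s. ?J v (Suc i) s \<and> regs s (fr J) = i)"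
    if "i < r" for v i
  proof (rule triple_run, goal_cases)
    case (2 s)
    \<comment> \<open>Ranks start at 1, so \<open>Lab = 0\<close> really singles out the
      nonterminals.\<close>
    have "v \<in> X \<Longrightarrow> rank X v \<noteq> 0"
      using bij_betwE[OF num] by fastforce
    then show ?case
      using 2 that lists_written_store[of v i "arrs s ''lambda''"]
      by (cases "v \<in> X"; cases "rank X v = Suc i") (auto simp: defs lists_def)
  qed simp_all
  have 3: "triple (?J v 0) (for_upto J (fr R) ?c) (r * (8 + 4) + 3)
      (\<lambda>s. ?O (Suc v) s \<and> regs s (fr I) = v)" for v
  proof -
    have "triple (?J v 0) (for_upto J (fr R) ?c) (r * (8 + 4) + 3) (?J v r)"
      by (rule triple_for_loop[where I = "?J v"]; (rule body)?; simp add: defs)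
    then show ?thesis
      by (rule triple_conseq) (auto intro: lists_written_row)
  qed
  have 4: "triple (\<lambda>s. ?O v s \<and> regs s (fr I) = v)
      (Load (fr Lab) (fr NumA) (fr I) ;; for_upto J (fr R) ?c) (r * 12 + 4)
      (\<lambda>s. ?O (Suc v) s \<and> regs s (fr I) = v)" if "v < n" for v
    by (rule triple_conseq[OF triple_Seq[OF 2[OF that] 3]]) simp_all
  have 5: "triple (?O 0) (for_upto I (fr N) (Load (fr Lab) (fr NumA) (fr I) ;; for_upto J (fr R) ?c))
      (n * (r * 12 + 4 + 4) + 3) (?O n)"
    by (rule triple_for_loop[where I = ?O]; (rule 4)?; simp add: defs)
  show ?thesis
    unfolding write_lists_def by (rule triple_conseq[OF triple_Seq[OF 1 5]]) simp_all
qed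

lemma enc_la_padded:
  assumes "padded_written a s" "lists_written n 0 (arrs s ''lambda'')"
  shows "enc_la (padded_graph a) r lists (padded_size a) s"
proof -
  have v: "verts (padded_graph a) = {..<n}" by (simp add: padded_graph_def vs)
  have "arrs s ''G'' (u * n + v) = card (delta (padded_graph a) {u} {v})" if "u < n" "v < n" for u v
  proof -
    have "(u * n + v) div n = u" "(u * n + v) mod n = v" using that by auto
    then have "mult (u * n + v) = card (delta G {u} {v})" by (simp add: mult_def)
    then show ?thesis
      using assms(1) that terminals_less row_major_less[OF that]
      by (auto simp: padded_written_def delta_padded_graph row_major_inj)
  qed
  moreover have "arrs s ''lambda'' (v * r + i) = (if i \<in> lists v then 1 else 0)"
    if "v < n" "i \<in> {1..r}" for v i
    using that assms(2) unfolding lists_written_def cell_def by (cases i) auto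
  moreover have "arrs s ''alpha'' (i * r + j) = padded_size a {i, j}"
    if "i \<in> {1..r}" "j \<in> {1..r}" "i \<noteq> j" for i j
    using that assms(1) unfolding padded_written_def cell_def by (cases i; cases j) auto
  ultimately show ?thesis
    using assms(1) by (simp add: enc_la_def enc_graph_def Let_def v padded_written_def)
qed

definition solver_time :: nat where
  "solver_time = nat \<lfloor>T n (r * l)\<rfloor>"

text \<open>\<open>row_ok\<close> fixes the weight at \<open>r * l\<close>, and
  \<open>r \<le> n\<close> puts the instance into the range where the time bound is promised.
  \<open>working\<close> survives because it depends only on names that \<open>P\<close> does not
  assign.\<close>

lemma solver_triple:
  assumes "row_ok r l a"
  shows "triple (\<lambda>s. working a s \<and> padded_written a s \<and> lists_written n 0 (arrs s ''lambda''))
    P solver_time (\<lambda>s. working a s \<and> la_correct (padded_graph a) r lists (padded_size a) s)"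
proof (rule tripleI, elim conjE)
  fix s assume s: "working a s" "padded_written a s" "lists_written n 0 (arrs s ''lambda'')"
  obtain k s' where k: "exec P s k s'" "la_correct (padded_graph a) r lists (padded_size a) s'"
    "r \<le> card (verts (padded_graph a)) + 1 \<longrightarrow>
      real k \<le> T (card (verts (padded_graph a))) (la_weight r (padded_size a))"
    by (rule solves_list_allocationE[OF solver padded_instance enc_la_padded[OF s(2,3)]])
  have "real k \<le> T n (r * l)"
    using k(3) n padded_weight[OF assms] by (simp add: padded_graph_def)
  then have "k \<le> solver_time" by (simp add: solver_time_def le_nat_floor)
  moreover have "working a s'"
    using s(1) by (simp add: working_def setup_defs exec_unassigned_reg[OF k(1) unassigned(1)]
        exec_unassigned_arr[OF k(1) unassigned(2)])
  ultimately show "\<exists>k s'. exec P s k s' \<and> k \<le> solver_time \<and>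
      (working a s' \<and> la_correct (padded_graph a) r lists (padded_size a) s')"
    using k by blast
qed

text \<open>The class array left by the solver is already the answer and must stay untouched, which
  \<open>Go = 0\<close> ensures by ending the search. \<open>Zero\<close> is kept for the final copy
  of \<open>Found\<close> to the answer register.\<close>

definition finished :: "state \<Rightarrow> bool" where
  "finished s \<longleftrightarrow> regs s (fr Zero) = 0 \<and> regs s (fr Go) = 0 \<and>
     (regs s (fr Found) = 1 \<and> mmc_solution G l r X (out_class G s ` {1..r}) \<or>
      regs s (fr Found) = 0 \<and> (\<nexists>\<P>. mmc_solution G l r X \<P>))"

lemma out_class_update [simp]:
  "out_class H (s\<lparr>regs := f\<rparr>) = out_class H s"
  by (simp add: out_class_def fun_eq_iff)

lemma answer_triple:
  assumes "row_ok r l a"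
  shows "triple (\<lambda>s. working a s \<and> la_correct (padded_graph a) r lists (padded_size a) s)
    (IfNZ ''ans'' (Const (fr Found) 1 ;; Const (fr Go) 0) Skip) 3
    (\<lambda>s. working a s \<and> \<not> feasible a \<or> finished s)"
proof (rule triple_run, goal_cases)
  case (2 s)
  have out: "out_class (padded_graph a) s = out_class G s"
    by (simp add: out_class_def fun_eq_iff padded_graph_def)
  consider "regs s ''ans'' = 1" "la_solution (padded_graph a) r lists (padded_size a) (out_class G s)"
    | "regs s ''ans'' = 0" "\<not> feasible a"
    using 2 unfolding la_correct_def feasible_def out by (elim conjE disjE) auto
  then show ?case
  proof cases
    case 1
    then show ?thesis
      using 2 solution_of_padded[OF assms 1(2)] by (simp add: finished_def working_def setup_defs)
  next
    case inf: 2
    then show ?thesis using 2 by simp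
  qed
qed simp_all

lemma try_sizes_triple:
  assumes "row_ok r l a"
  shows "triple (\<lambda>s. working a s \<and> sizes_written a r 0 (arrs s ''alpha'') \<and>
      regs s (fr W) = la_weight r (cut_size r a))
    try_sizes (n * n * 6 + n * (r * 12 + 8) + solver_time + 29)
    (\<lambda>s. working a s \<and> \<not> feasible a \<or> finished s)"
  unfolding try_sizes_def
  by (rule triple_conseq[OF triple_Seq[OF restore_graph_triple triple_Seq[OF pad_instance_triple
    triple_Seq[OF write_lists_triple triple_Seq[OF solver_triple[OF assms] answer_triple[OF assms]]]]]])
    simp_all

section \<open>Advancing to the next guess\<close>

lemma next_digits_triple:
  assumes a: "a \<in> digit_vectors (num_digits r) l (r * l)"
  defines "can \<equiv> can_incr (num_digits r) l (r * l) a"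
  shows "triple (working a) next_digits (num_digits r * 14 + 6)
    (\<lambda>s. (\<exists>p<num_digits r. can p \<and> (\<forall>q<p. \<not> can q) \<and> working (incr p a) s) \<or>
      (\<forall>q<num_digits r. \<not> can q) \<and> regs s (fr Zero) = 0 \<and> regs s (fr Go) = 0 \<and> regs s (fr Found) = 0)"
proof -
  \<comment> \<open>\<open>A i\<close> describes the scan in progress: all positions below
    \<open>i\<close> were stuck and are now 0. \<open>B\<close> describes it after a success, when
    the remaining rounds change nothing of interest.\<close>
  define A where "A i s \<longleftrightarrow> setup_done s \<and> regs s (fr Found) = 0 \<and> regs s (fr Go) = 1 \<and> regs s (fr Cont) = 1 \<and>
    (\<forall>q<i. \<not> can q) \<and> (\<forall>p<num_digits r. arrs s (fr DigitA) p = (if p < i then 0 else a p)) \<and>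
    regs s (fr Tot) = (\<Sum>q\<in>{i..<num_digits r}. a q)" for i s
  define B where "B s \<longleftrightarrow> regs s (fr Cont) = 0 \<and>
    (\<exists>p<num_digits r. can p \<and> (\<forall>q<p. \<not> can q) \<and> working (incr p a) s)" for s
  let ?I = "\<lambda>i s. A i s \<or> B s"
  let ?c = "IfNZ (fr Cont)
         (Load (fr Lab) (fr DigitA) (fr I) ;; Sub (fr D) (fr L) (fr Lab) ;;
          Sub (fr QT) (fr RL) (fr Tot) ;;
          IfNZ (fr D)
            (IfNZ (fr QT)
              (Add (fr Lab) (fr Lab) (fr One) ;; Store (fr DigitA) (fr I) (fr Lab) ;;
               Add (fr Tot) (fr Tot) (fr One) ;; Const (fr Cont) 0)
              (Sub (fr Tot) (fr Tot) (fr Lab) ;; Store (fr DigitA) (fr I) (fr Zero)))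
            (Sub (fr Tot) (fr Tot) (fr Lab) ;; Store (fr DigitA) (fr I) (fr Zero)))
         Skip"
  note defs = working_def setup_defs
  have 1: "triple (working a) (Const (fr Cont) 1) 1 (?I 0)"
    by (rule triple_run; simp add: A_def defs lessThan_atLeast0)
  have body: "triple (\<lambda>s. ?I i s \<and> regs s (fr I) = i) ?c 10 (\<lambda>s. ?I (Suc i) s \<and> regs s (fr I) = i)"
    if i: "i < num_digits r" for i
  proof (rule triple_run, goal_cases)
    case (2 s)
    have sum: "(\<Sum>q\<in>{i..<num_digits r}. a q) = a i + (\<Sum>q\<in>{Suc i..<num_digits r}. a q)"
      using i by (rule sum.atLeast_Suc_lessThan)
    have can: "can i \<longleftrightarrow> a i < l \<and> (\<Sum>q\<in>{i..<num_digits r}. a q) < r * l"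
      by (simp add: can_def can_incr_def)
    consider "B s" | "A i s" "can i" | "A i s" "\<not> can i"
      using 2 by blast
    then show ?case
    proof cases
      case 1
      then show ?thesis using 2 by (simp add: B_def)
    next
      case inc: 2
      then have "working (incr i a) (run ?c s)" "regs (run ?c s) (fr Cont) = 0"
        "regs (run ?c s) (fr I) = i"
        using 2 i sum_incr[OF i, of a] unfolding can
        by (auto simp: A_def defs incr_def)
      then have "B (run ?c s)" "regs (run ?c s) (fr I) = i"
        using inc i unfolding A_def B_def by blast+
      then show ?thesis by blast
    next
      case noinc: 3
      then have "A (Suc i) (run ?c s)" "regs (run ?c s) (fr I) = i"
        using 2 i sum by (auto simp: A_def defs can less_Suc_eq)
      then show ?thesis by blast
    qed
  qed simp_all
  have 2: "triple (?I 0) (for_upto I (fr M) ?c) (num_digits r * (10 + 4) + 3) (?I (num_digits r))"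
  proof (rule triple_for_loop[where I = ?I], goal_cases)
    case (2 i s)
    then show ?case by (auto simp: A_def B_def defs)
  next
    case (3 i s x y)
    let ?s = "s\<lparr>regs := (regs s)(fr I := x, fr Test := y, fr One := 1)\<rparr>"
    have "A i s \<Longrightarrow> A i ?s" by (simp add: A_def defs)
    moreover have "working b s \<Longrightarrow> working b ?s" for b by (simp add: defs)
    then have "B s \<Longrightarrow> B ?s" unfolding B_def by auto
    ultimately show ?case using 3 by blast
  next
    case (4 s y)
    let ?s = "s\<lparr>regs := (regs s)(fr I := 0, fr Test := y)\<rparr>"
    have "A 0 s \<Longrightarrow> A 0 ?s" by (simp add: A_def defs)
    moreover have "working b s \<Longrightarrow> working b ?s" for b by (simp add: defs)
    then have "B s \<Longrightarrow> B ?s" unfolding B_def by auto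
    ultimately show ?case using 4 by blast
  next
    case (5 i)
    then show ?case by (rule body)
  qed simp
  have 3: "triple (?I (num_digits r)) (IfNZ (fr Cont) (Const (fr Go) 0) Skip) 2
    (\<lambda>s. (\<exists>p<num_digits r. can p \<and> (\<forall>q<p. \<not> can q) \<and> working (incr p a) s) \<or>
      (\<forall>q<num_digits r. \<not> can q) \<and> regs s (fr Zero) = 0 \<and> regs s (fr Go) = 0 \<and> regs s (fr Found) = 0)"
    by (rule triple_run) (auto simp: A_def B_def defs)
  show ?thesis
    unfolding next_digits_def
    by (rule triple_conseq[OF triple_Seq[OF 1 triple_Seq[OF 2 3]]]) simp_all
qed


section \<open>The search loop\<close>

abbreviation vectors :: "(nat \<Rightarrow> nat) set" where
  "vectors \<equiv> digit_vectors (num_digits r) l (r * l)"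

abbreviation can :: "(nat \<Rightarrow> nat) \<Rightarrow> nat \<Rightarrow> bool" where
  "can \<equiv> can_incr (num_digits r) l (r * l)"

lemma search_body_triple:
  assumes a: "a \<in> vectors"
  shows "triple (working a) search_body (140 * (n * n) + solver_time)
    (\<lambda>s. finished s \<or> \<not> feasible a \<and>
      ((\<exists>p<num_digits r. can a p \<and> (\<forall>q<p. \<not> can a q) \<and> working (incr p a) s) \<or>
      (\<forall>q<num_digits r. \<not> can a q) \<and> regs s (fr Zero) = 0 \<and> regs s (fr Go) = 0 \<and> regs s (fr Found) = 0))"
proof -
  let ?t = "n * n * 6 + n * (r * 12 + 8) + solver_time + 29"
  have 1: "triple (\<lambda>s. working a s \<and> sizes_written a r 0 (arrs s ''alpha'') \<and>
      regs s (fr W) = la_weight r (cut_size r a) \<and> regs s (fr OK) = (if row_ok r l a then 1 else 0))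
    (IfNZ (fr OK) try_sizes Skip) (1 + ?t) (\<lambda>s. working a s \<and> \<not> feasible a \<or> finished s)"
  proof (rule triple_If)
    show "triple (\<lambda>s. (working a s \<and> sizes_written a r 0 (arrs s ''alpha'') \<and>
        regs s (fr W) = la_weight r (cut_size r a) \<and>
        regs s (fr OK) = (if row_ok r l a then 1 else 0)) \<and> regs s (fr OK) \<noteq> 0)
      try_sizes ?t (\<lambda>s. working a s \<and> \<not> feasible a \<or> finished s)"
    proof (cases "row_ok r l a")
      case True
      show ?thesis by (rule triple_conseq[OF try_sizes_triple[OF True]]) auto
    next
      case False
      then show ?thesis by (auto simp: triple_def)
    qed
  next
    show "triple (\<lambda>s. (working a s \<and> sizes_written a r 0 (arrs s ''alpha'') \<and>
        regs s (fr W) = la_weight r (cut_size r a) \<and>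
        regs s (fr OK) = (if row_ok r l a then 1 else 0)) \<and> regs s (fr OK) = 0)
      Skip ?t (\<lambda>s. working a s \<and> \<not> feasible a \<or> finished s)"
      by (rule triple_run) (auto simp: feasible_def split: if_splits)
  qed
  let ?post = "\<lambda>s. finished s \<or> \<not> feasible a \<and>
      ((\<exists>p<num_digits r. can a p \<and> (\<forall>q<p. \<not> can a q) \<and> working (incr p a) s) \<or>
      (\<forall>q<num_digits r. \<not> can a q) \<and> regs s (fr Zero) = 0 \<and> regs s (fr Go) = 0 \<and> regs s (fr Found) = 0)"
  have 2: "triple (\<lambda>s. working a s \<and> \<not> feasible a \<or> finished s) (IfNZ (fr Go) next_digits Skip)
      (1 + (num_digits r * 14 + 6)) ?post"
  proof (rule triple_If)
    show "triple (\<lambda>s. (working a s \<and> \<not> feasible a \<or> finished s) \<and> regs s (fr Go) \<noteq> 0)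
      next_digits (num_digits r * 14 + 6) ?post"
    \<comment> \<open>For a feasible \<open>a\<close> the precondition leaves only
      \<open>finished\<close>, which contradicts \<open>Go \<noteq> 0\<close>.\<close>
    proof (cases "feasible a")
      case True
      then show ?thesis by (auto simp: triple_def finished_def)
    next
      case False
      then show ?thesis
        by (intro triple_conseq[OF next_digits_triple[OF a]]) (auto simp: finished_def)
    qed
    show "triple (\<lambda>s. (working a s \<and> \<not> feasible a \<or> finished s) \<and> regs s (fr Go) = 0)
      Skip (num_digits r * 14 + 6) ?post"
      by (rule triple_run) (auto simp: working_def)
  qed
  have "1 \<le> n" "n \<le> n * n" "1 \<le> n * n" "r \<le> n * n" "r * r \<le> n * n" "n * r \<le> n * n"
    using n(1) r' by (auto intro: mult_le_mono order_trans[OF n(1)])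
  then have "(r * (r * 14 + 12) + 6) + ((1 + ?t) + (1 + (num_digits r * 14 + 6))) \<le>
      140 * (n * n) + solver_time"
    unfolding num_digits_def add_mult_distrib add_mult_distrib2 mult.assoc[symmetric] by linarith
  then show ?thesis
    unfolding search_body_def
    by (intro triple_conseq[OF triple_Seq[OF build_sizes_triple triple_Seq[OF 1 2]]])
qed

definition remaining :: "(nat \<Rightarrow> nat) \<Rightarrow> (nat \<Rightarrow> nat) set" where
  "remaining a = {b \<in> vectors. b = a \<or> lex_less a b}"

text \<open>The variant bounds the number of vectors not yet refuted, the current one included. No
  vector below the current one is feasible, so reaching the end of the order refutes the whole
  instance.\<close>

definition search_inv :: "nat \<Rightarrow> state \<Rightarrow> bool" where
  "search_inv m s \<longleftrightarrow> finished s \<or>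
     (\<exists>a\<in>vectors. working a s \<and> (\<forall>b\<in>vectors. feasible b \<longrightarrow> b \<in> remaining a) \<and>
        card (remaining a) \<le> m)"

lemma finite_remaining: "finite (remaining a)"
  unfolding remaining_def using finite_digit_vectors by simp

lemma search_inv_triple:
  "triple (\<lambda>s. search_inv m s \<and> regs s (fr Go) \<noteq> 0) search_body (140 * (n * n) + solver_time)
    (\<lambda>s. \<exists>m'<m. search_inv m' s)"
proof (rule tripleI)
  fix s assume s: "search_inv m s \<and> regs s (fr Go) \<noteq> 0"
  then obtain a where a: "a \<in> vectors" "working a s" "card (remaining a) \<le> m"
    and rem: "\<And>b. b \<in> vectors \<Longrightarrow> feasible b \<Longrightarrow> b \<in> remaining a"
    unfolding search_inv_def by (auto simp: finished_def)
  have "a \<in> remaining a" using a by (simp add: remaining_def)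
  then have m: "0 < m"
    using a(3) finite_remaining card_gt_0_iff by (metis empty_iff gr_zeroI le_zero_eq less_irrefl)
  obtain k s' where k: "exec search_body s k s'" "k \<le> 140 * (n * n) + solver_time"
    and post: "finished s' \<or> \<not> feasible a \<and>
      ((\<exists>p<num_digits r. can a p \<and> (\<forall>q<p. \<not> can a q) \<and> working (incr p a) s') \<or>
      (\<forall>q<num_digits r. \<not> can a q) \<and> regs s' (fr Zero) = 0 \<and> regs s' (fr Go) = 0 \<and> regs s' (fr Found) = 0)"
    by (rule tripleE[OF search_body_triple[OF a(1)] a(2)])
  have rem': "b \<in> vectors \<Longrightarrow> feasible b \<Longrightarrow> \<not> feasible a \<Longrightarrow> lex_less a b" for b
    using rem[of b] by (auto simp: remaining_def)
  from post have "\<exists>m'<m. search_inv m' s'"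
  proof (elim disjE conjE exE)
    assume "finished s'"
    then show ?thesis using m by (auto simp: search_inv_def)
  next
    fix p
    assume 2: "\<not> feasible a" "p < num_digits r" "can a p" "\<forall>q<p. \<not> can a q" "working (incr p a) s'"
    have v: "incr p a \<in> vectors" using incr_in_digit_vectors[OF a(1) 2(2,3)] .
    have "b \<in> remaining (incr p a)" if "b \<in> vectors" "feasible b" for b
      using incr_least[OF a(1) that(1) rem'[OF that 2(1)] 2(4)] that by (simp add: remaining_def)
    moreover have "remaining (incr p a) \<subset> remaining a"
    proof
      show "remaining (incr p a) \<subseteq> remaining a"
        using lex_less_incr[of a p] by (auto simp: remaining_def intro: lex_less_trans)
      have "a \<notin> remaining (incr p a)"
        using lex_less_incr[of a p] lex_less_irrefl[of a] lex_less_trans[of a "incr p a" a]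
        by (auto simp: remaining_def)
      then show "remaining (incr p a) \<noteq> remaining a" using \<open>a \<in> remaining a\<close> by blast
    qed
    then have "card (remaining (incr p a)) < card (remaining a)"
      by (rule psubset_card_mono[OF finite_remaining])
    then have "card (remaining (incr p a)) < m" using a(3) by linarith
    ultimately show ?thesis
      using v 2(5) unfolding search_inv_def by (intro exI[of _ "card (remaining (incr p a))"]) auto
  next
    assume 3: "\<not> feasible a" "\<forall>q<num_digits r. \<not> can a q" "regs s' (fr Zero) = 0"
      "regs s' (fr Go) = 0" "regs s' (fr Found) = 0"
    have "\<not> feasible b" if "b \<in> vectors" for b
      using no_incr_maximal[OF a(1) that 3(2)] rem'[OF that _ 3(1)] by blast
    then have "finished s'"
      using feasible_of_solution 3 unfolding finished_def by blast
    then show ?thesis using m by (auto simp: search_inv_def)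
  qed
  then show "\<exists>k s'. exec search_body s k s' \<and> k \<le> 140 * (n * n) + solver_time \<and>
      (\<exists>m'<m. search_inv m' s')"
    using k by blast
qed

lemma zero_vector: "(\<lambda>_. 0) \<in> vectors"
  by (simp add: digit_vectors_def)

lemma search_triple:
  "triple enc search (card vectors * (243 * (n * n) + solver_time)) (mmc_correct G l r X)"
proof -
  have 1: "triple enc prepare (100 * (n * n)) (search_inv (card vectors))"
  proof (rule triple_conseq[OF prepare_triple])
    fix s assume "working (\<lambda>_. 0) s"
    moreover have "remaining (\<lambda>_. 0) = vectors"
      using zero_or_lex_less[of "num_digits r"] by (auto simp: remaining_def digit_vectors_def)
    ultimately show "search_inv (card vectors) s"
      using zero_vector unfolding search_inv_def by auto
  qed auto
  have 2: "triple (search_inv (card vectors)) (WhileNZ (fr Go) search_body)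
      (card vectors * (140 * (n * n) + solver_time + 1) + 1)
      (\<lambda>s. \<exists>m. search_inv m s \<and> regs s (fr Go) = 0)"
    by (rule triple_While[OF search_inv_triple])
  have 3: "triple (\<lambda>s. \<exists>m. search_inv m s \<and> regs s (fr Go) = 0) (Add ''ans'' (fr Found) (fr Zero)) 1
      (mmc_correct G l r X)"
    by (rule triple_run)
      (auto simp: search_inv_def working_def finished_def mmc_correct_def)
  have "1 \<le> card vectors"
    using zero_vector finite_digit_vectors card_gt_0_iff[of vectors] by (auto simp: Suc_le_eq)
  moreover have "1 \<le> n * n" using n(1) r' by (auto simp: Suc_le_eq)
  \<comment> \<open>\<open>243 = 100 + 140 + 1 + 2\<close>: the preparation, a round, its loop test,
    and the last test together with the final copy, all charged to \<open>d * q\<close>.\<close>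
  moreover have "100 * q + ((d * (140 * q + t + 1) + 1) + 1) \<le> d * (243 * q + t)"
    if "1 \<le> d" "1 \<le> q" for d q t :: nat
  proof -
    have "d * (140 * q + t + 1) = 140 * (d * q) + d * t + d" "d * (243 * q + t) = 243 * (d * q) + d * t"
      by (simp_all add: algebra_simps)
    moreover have "q \<le> d * q" "d \<le> d * q" "1 \<le> d * q" using that by auto
    ultimately show ?thesis by linarith
  qed
  ultimately show ?thesis
    unfolding search_def by (intro triple_conseq[OF triple_Seq[OF 1 triple_Seq[OF 2 3]]])
qed

end

section \<open>The whole program\<close>

definition iterations :: "nat \<Rightarrow> nat \<Rightarrow> nat" where
  "iterations r l = (if r < 2 then 1 else card (digit_vectors (num_digits r) l (r * l)))"

context program
begin

lemma no_terminals_triple: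
  assumes "mmc_instance G 0 X" "verts G = {..<n}"
  shows "triple (\<lambda>s. regs s ''n'' = n) (IfNZ ''n'' (Const ''ans'' 0) (Const ''ans'' 1)) 2
    (mmc_correct G l 0 X)"
proof (rule triple_run, goal_cases)
  case (2 s)
  have "mmc_solution G l 0 X {}" if "n = 0"
    using that assms by (simp add: mmc_solution_def partition_on_def)
  moreover have "\<not> mmc_solution G l 0 X \<P>" if "n \<noteq> 0" for \<P>
  proof
    assume sol: "mmc_solution G l 0 X \<P>"
    then have "finite \<P>" "card \<P> = 0" "\<Union> \<P> = {..<n}"
      using finite_elements[of "{..<n}" \<P>] assms by (auto simp: mmc_solution_def partition_on_def)
    then show False using that by auto
  qed
  ultimately show ?case using 2 by (auto simp: mmc_correct_def)
qed simp_all

lemma one_terminal_triple: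
  assumes inst: "mmc_instance G 1 X" and vs: "verts G = {..<n}"
  shows "triple (\<lambda>s. regs s ''n'' = n \<and> regs s (fr One) = 1)
    (for_upto I ''n'' (Store ''out'' (fr I) (fr One)) ;; Const ''ans'' 1) (n * 5 + 4)
    (mmc_correct G l 1 X)"
proof -
  let ?I = "\<lambda>i s. regs s ''n'' = n \<and> regs s (fr One) = 1 \<and> (\<forall>v<i. arrs s ''out'' v = 1)"
  have 1: "triple (\<lambda>s. regs s ''n'' = n \<and> regs s (fr One) = 1)
      (for_upto I ''n'' (Store ''out'' (fr I) (fr One))) (n * (1 + 4) + 3) (?I n)"
    by (rule triple_for_loop[where I = ?I]; (rule triple_run)?; simp add: less_Suc_eq)
  have "X \<subseteq> {..<n}" "card X = 1" using inst vs by (auto simp: mmc_instance_def)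
  then have "{..<n} \<inter> X = X" "n \<noteq> 0" by (auto intro!: gr0I)
  moreover have "card {e \<in> edges G. card (ends G e \<inter> {..<n}) = 1} \<le> l"
  proof -
    have "ends G e \<inter> {..<n} = ends G e \<and> card (ends G e) = 2" if "e \<in> edges G" for e
      using inst that by (auto simp: mmc_instance_def wf_mgraph_def vs)
    then have "{e \<in> edges G. card (ends G e \<inter> {..<n}) = 1} = {}" by auto
    then show ?thesis by (metis card.empty le0)
  qed
  ultimately have sol: "mmc_solution G l 1 X {{..<n}}"
    using \<open>card X = 1\<close> by (auto simp: mmc_solution_def partition_on_def vs disjoint_def lessThan_empty_iff
        simp del: One_nat_def)
  have 2: "triple (?I n) (Const ''ans'' 1) 1 (mmc_correct G l 1 X)"
  proof (rule triple_run, goal_cases)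
    case (2 s)
    then have "out_class G s 1 = {..<n}" by (auto simp: out_class_def vs)
    then show ?case using sol by (simp add: mmc_correct_def out_class_def)
  qed simp_all
  show ?thesis
    by (rule triple_conseq[OF triple_Seq[OF 1 2]]) simp_all
qed

theorem multiway_cut_program_correct:
  fixes G :: "(nat, nat) mgraph"
  assumes solver: "solves_list_allocation P T"
    and inst: "mmc_instance G r X" and enc: "enc_mmc G l r X s"
  shows "\<exists>k s'. exec multiway_cut_program s k s' \<and> mmc_correct G l r X s' \<and>
    real k \<le> 1000 * real (iterations r l) * T (card (verts G)) (r * l)"
proof -
  define n where "n = card (verts G)"
  have s: "verts G = {..<n}" "regs s ''n'' = n" "regs s ''r'' = r"
    using enc by (auto simp: enc_mmc_def enc_graph_def Let_def n_def)
  have Xn: "X \<subseteq> {..<n}" "card X = r" using inst s by (auto simp: mmc_instance_def)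
  then have rn: "r \<le> n" using card_mono[of "{..<n}" X] by simp
  \<comment> \<open>\<open>n = 0\<close> forces \<open>r = 0\<close> and thus weight 0, which is the
    case that \<open>lower_bound_one\<close> covers for empty graphs.\<close>
  have T1: "1 \<le> T n (r * l)"
  proof (cases "n = 0")
    case True
    then show ?thesis using rn lower_bound_one[OF solver, of n "r * l"] by simp
  next
    case False
    then show ?thesis using lower_bound(1)[OF solver] by simp
  qed
  consider "r = 0" | "r = 1" | "2 \<le> r" by linarith
  then show ?thesis
  proof cases
    case 1
    obtain k s' where k: "exec (IfNZ ''n'' (Const ''ans'' 0) (Const ''ans'' 1)) s k s'" "k \<le> 2"
      "mmc_correct G l 0 X s'"
      by (rule tripleE[OF no_terminals_triple[of G X n]]) (use inst s 1 in auto)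
    have "exec multiway_cut_program s (1 + k) s'"
      unfolding multiway_cut_program_def using 1 s by (intro exec.IfFalse k(1)) simp
    moreover have "real (1 + k) \<le> 1000 * real (iterations r l) * T n (r * l)"
      using k(2) T1 1 by (simp add: iterations_def)
    ultimately show ?thesis using k(3) 1 unfolding n_def by blast
  next
    case 2
    let ?c = "Const (fr One) 1 ;; Sub (fr D) ''r'' (fr One)"
    obtain k1 where k1: "exec ?c s k1 (run ?c s)" "k1 \<le> cost ?c"
      using exec_run[of ?c s] by auto
    obtain k s' where k: "exec (for_upto I ''n'' (Store ''out'' (fr I) (fr One)) ;; Const ''ans'' 1) (run ?c s) k s'"
      "k \<le> n * 5 + 4" "mmc_correct G l 1 X s'"
      by (rule tripleE[OF one_terminal_triple[of G X n], of "run ?c s"]) (use inst s 2 in auto)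
    have "exec multiway_cut_program s (1 + (k1 + (1 + k))) s'"
      unfolding multiway_cut_program_def
      by (intro exec.IfTrue exec.Seq[OF k1(1)] exec.IfFalse k(1)) (use 2 s in simp_all)
    moreover have "n \<le> n * n" "1 \<le> n * n" using rn 2 by auto
    then have "1 + (k1 + (1 + k)) \<le> 20 * (n * n)" using k1(2) k(2) unfolding cost.simps by linarith
    then have "real (1 + (k1 + (1 + k))) \<le> 20 * real (n * n)" by linarith
    then have "real (1 + (k1 + (1 + k))) \<le> 1000 * real (iterations r l) * T n (r * l)"
      using lower_bound(2)[OF solver, of n "r * l"] T1 rn 2 by (simp add: iterations_def)
    ultimately show ?thesis using k(3) 2 unfolding n_def by blast
  next
    case 3
    interpret search_instance P fr G n l r X T
      using solver inst 3 s by unfold_locales auto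
    let ?c = "Const (fr One) 1 ;; Sub (fr D) ''r'' (fr One)"
    obtain k1 where k1: "exec ?c s k1 (run ?c s)" "k1 \<le> cost ?c"
      using exec_run[of ?c s] by auto
    have enc': "enc_mmc G l r X (run ?c s)" using enc by simp
    obtain k s' where k: "exec search (run ?c s) k s'"
      "k \<le> card vectors * (243 * (n * n) + solver_time)" "mmc_correct G l r X s'"
      by (rule tripleE[OF search_triple enc'])
    have "exec multiway_cut_program s (1 + (k1 + (1 + k))) s'"
      unfolding multiway_cut_program_def
      by (intro exec.IfTrue exec.Seq[OF k1(1)] k(1)) (use 3 s in simp_all)
    moreover have "real (1 + (k1 + (1 + k))) \<le> 1000 * real (iterations r l) * T n (r * l)"
    proof -
      have "1 \<le> card vectors"
        using zero_vector finite_digit_vectors card_gt_0_iff[of vectors] by (auto simp: Suc_le_eq)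
      have "real solver_time \<le> T n (r * l)"
        using T1 by (simp add: solver_time_def)
      moreover have "real (n * n) \<le> 4 * T n (r * l)"
        using lower_bound(2)[OF solver, of n "r * l"] rn 3 by simp
      \<comment> \<open>\<open>973 = 243 * 4 + 1\<close>: the work of order \<open>n * n\<close> is
        charged to \<open>T\<close> by \<open>lower_bound\<close>. At most 4 steps before the search
        then lead to 977, within the 1000 of the claim.\<close>
      ultimately have "243 * real (n * n) + real solver_time \<le> 973 * T n (r * l)" by linarith
      then have "real (card vectors) * (243 * real (n * n) + real solver_time) \<le>
          real (card vectors) * (973 * T n (r * l))"
        by (rule mult_left_mono) simp
      moreover have "real k \<le> real (card vectors) * (243 * real (n * n) + real solver_time)"
        using of_nat_mono[OF k(2), where 'a = real] by simp
      moreover have "1 * 1 \<le> real (card vectors) * T n (r * l)"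
        using T1 \<open>1 \<le> card vectors\<close> by (intro mult_mono) auto
      moreover have "real k1 \<le> 2" using k1(2) by simp
      ultimately have "real (1 + (k1 + (1 + k))) \<le> 977 * (real (card vectors) * T n (r * l))"
        by (simp add: algebra_simps)
      then show ?thesis
        using \<open>1 * 1 \<le> real (card vectors) * T n (r * l)\<close> 3 by (simp add: iterations_def)
    qed
    ultimately show ?thesis using k(3) unfolding n_def by blast
  qed
qed

end

text \<open>Names longer than all names in use are fresh, and different lengths keep them
  distinct.\<close>

lemma exists_program: "\<exists>fr. program P fr"
proof -
  define F where "F = assigned_regs P \<union> assigned_arrs P \<union>
    {''n'', ''r'', ''l'', ''ans'', ''G'', ''T'', ''lambda'', ''alpha'', ''out''}"
  have "finite F" using finite_assigned by (simp add: F_def)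
  then have "finite (length ` F)" by simp
  then obtain K where K: "\<forall>x\<in>length ` F. x \<le> K" using finite_nat_set_iff_bounded_le by blast
  define fr :: "slot \<Rightarrow> vname" where "fr x = replicate (Suc K + to_nat x) (CHR ''x'')" for x
  have "fr x \<notin> F" for x
  proof
    assume "fr x \<in> F"
    then have "length (fr x) \<le> K" using K by blast
    then show False by (simp add: fr_def)
  qed
  moreover have "inj fr"
  proof (rule injI)
    fix x y assume "fr x = fr y"
    then have "length (fr x) = length (fr y)" by simp
    then show "x = y" by (simp add: fr_def)
  qed
  ultimately have "program P fr" by unfold_locales (auto simp: F_def)
  then show ?thesis by blast
qed

subsection \<open>The number of iterations\<close>

lemma iterations_pos: "1 \<le> iterations r l"
proof -
  have "(\<lambda>_. 0) \<in> digit_vectors (num_digits r) l (r * l)" by (simp add: digit_vectors_def)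
  then have "card (digit_vectors (num_digits r) l (r * l)) > 0"
    using finite_digit_vectors card_gt_0_iff by blast
  then show ?thesis by (simp add: iterations_def)
qed

text \<open>The count by digit sum has exponent \<open>r * l\<close> and base
  \<open>num_digits r + 1\<close>, which is at most \<open>r ^ 3\<close> once
  \<open>r \<ge> 2\<close>.\<close>

lemma log_iterations_le_terminals:
  assumes r: "2 \<le> r"
  shows "log 2 (real (iterations r l)) \<le> 3 * (real r * (real l * log 2 (real r)))"
proof -
  have "r * r * 2 \<le> r * r * r" "r * 2 \<le> r * r" "4 \<le> r * r"
    using r mult_le_mono[OF r r] by auto
  then have "num_digits r + 1 \<le> r ^ 3"
    unfolding num_digits_def power3_eq_cube by linarith
  then have "(num_digits r + 1) ^ (r * l) \<le> (r ^ 3) ^ (r * l)"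
    by (rule power_mono) simp
  then have "iterations r l \<le> r ^ (3 * (r * l))"
    using card_digit_vectors_le'[of "num_digits r" l "r * l"] r
    by (simp add: iterations_def power_mult)
  then have "real (iterations r l) \<le> real r ^ (3 * (r * l))"
    by (metis of_nat_le_iff of_nat_power)
  then have "log 2 (real (iterations r l)) \<le> log 2 (real r ^ (3 * (r * l)))"
    using iterations_pos[of r l] r by (subst log_le_cancel_iff) auto
  also have "\<dots> = real (3 * (r * l)) * log 2 (real r)"
    using r by (intro log_nat_power) simp
  finally show ?thesis by (simp add: algebra_simps)
qed

text \<open>The count by single digits, with \<open>l + 1 \<le> l ^ 2\<close> and
  \<open>num_digits r \<le> 2 * (r * r)\<close>. The first inequality is where
  \<open>l \<ge> 2\<close> enters.\<close>

lemma log_iterations_le_size: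
  assumes r: "2 \<le> r" and l: "2 \<le> l"
  shows "log 2 (real (iterations r l)) \<le> 4 * (real r * (real r * log 2 (real l)))"
proof -
  have "r * 2 \<le> r * r" "4 \<le> r * r" using r mult_le_mono[OF r r] by auto
  then have m: "num_digits r \<le> 2 * (r * r)"
    unfolding num_digits_def using r by linarith
  have "l * 2 \<le> l * l" using l by simp
  then have "l + 1 \<le> l ^ 2" unfolding power2_eq_square using l by linarith
  then have "(l + 1) ^ num_digits r \<le> (l ^ 2) ^ num_digits r"
    by (rule power_mono) simp
  also have "\<dots> \<le> (l ^ 2) ^ (2 * (r * r))"
    using m l by (intro power_increasing) auto
  finally have "iterations r l \<le> l ^ (4 * (r * r))"
    using card_digit_vectors_le[of "num_digits r" l "r * l"] r
    by (simp add: iterations_def power_mult[symmetric])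
  then have "real (iterations r l) \<le> real l ^ (4 * (r * r))"
    by (metis of_nat_le_iff of_nat_power)
  then have "log 2 (real (iterations r l)) \<le> log 2 (real l ^ (4 * (r * r)))"
    using iterations_pos[of r l] l by (subst log_le_cancel_iff) auto
  also have "\<dots> = real (4 * (r * r)) * log 2 (real l)"
    using l by (intro log_nat_power) simp
  finally show ?thesis by (simp add: algebra_simps)
qed

text \<open>The constant factor 1000 moves into the exponent, where it costs less than 10.\<close>

definition exponent :: "nat \<Rightarrow> nat \<Rightarrow> real" where
  "exponent r l = log 2 (1000 * real (iterations r l))"

lemma exponent_bounds: "0 \<le> exponent r l" "exponent r l \<le> 10 + log 2 (real (iterations r l))"
proof -
  have it: "1 \<le> real (iterations r l)" using iterations_pos[of r l] by simp
  then show "0 \<le> exponent r l" by (simp add: exponent_def)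
  have "log 2 1000 \<le> log 2 (2 ^ 10 :: real)" by (subst log_le_cancel_iff) auto
  also have "\<dots> = 10" by (subst log_nat_power) auto
  finally show "exponent r l \<le> 10 + log 2 (real (iterations r l))"
    using it by (simp add: exponent_def log_mult)
qed

text \<open>The comparison function is at least 2 on this range and so absorbs the additive 10;
  hence \<open>14 = 10 + 4\<close>. The principal filter makes one constant valid on the whole
  range, not only eventually.\<close>

lemma exponent_bigo_large:
  "(\<lambda>(r, l). exponent r l) \<in> O[principal {(r, l). 2 \<le> r \<and> 2 \<le> l}](\<lambda>(r, l).
    real r * min (real l * log 2 (real r)) (real r * log 2 (real l)))"
proof (rule bigoI[of _ 14], unfold eventually_principal, safe)
  fix r l :: nat
  assume r: "2 \<le> r" and l: "2 \<le> l"
  have logs: "1 \<le> log 2 (real r)" "1 \<le> log 2 (real l)"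
    using r l by (auto simp: le_log_iff)
  define F where "F = real r * min (real l * log 2 (real r)) (real r * log 2 (real l))"
  have "2 * 1 \<le> real l * log 2 (real r)" "2 * 1 \<le> real r * log 2 (real l)"
    using r l logs by (intro mult_mono; simp)+
  then have "2 * 1 \<le> F" unfolding F_def using r by (intro mult_mono) auto
  moreover have "log 2 (real (iterations r l)) \<le> 4 * F"
  proof (cases "real l * log 2 (real r) \<le> real r * log 2 (real l)")
    case True
    then have "F = real r * (real l * log 2 (real r))" by (simp add: F_def)
    then show ?thesis using log_iterations_le_terminals[OF r, of l] \<open>2 * 1 \<le> F\<close> by linarith
  next
    case False
    then show ?thesis using log_iterations_le_size[OF r l] by (simp add: F_def)
  qed
  ultimately have "norm (exponent r l) \<le> 14 * norm F"
    using exponent_bounds[of r l] by simp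
  then show "norm (exponent r l) \<le> 14 *
      norm (real r * min (real l * log 2 (real r)) (real r * log 2 (real l)))"
    by (simp only: F_def)
qed

text \<open>For \<open>l = 1\<close> the term with \<open>log l\<close> vanishes, although with
  \<open>r \<ge> 2\<close> there are several guesses, so only the term with \<open>log r\<close> is
  kept. That term is itself 0 for \<open>r < 2\<close> or \<open>l = 0\<close>, and the added 1 pays
  for the constant factor.\<close>

lemma exponent_bigo_small:
  "(\<lambda>(r, l). exponent r l) \<in> O[principal {(r, l). r < 2 \<or> l < 2}](\<lambda>(r, l).
    1 + real r * (real l * log 2 (real r)))"
proof (rule bigoI[of _ 10], unfold eventually_principal, rule ballI)
  fix x :: "nat \<times> nat"
  obtain r l where x: "x = (r, l)" by (cases x)
  define F where "F = real r * (real l * log 2 (real r))"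
  have "0 \<le> F \<and> log 2 (real (iterations r l)) \<le> 3 * F"
  proof (cases "r < 2")
    case True
    then have "r = 0 \<or> r = 1" by linarith
    then show ?thesis by (auto simp: F_def iterations_def)
  next
    case False
    then show ?thesis using log_iterations_le_terminals[of r l] by (simp add: F_def)
  qed
  then have "norm (exponent r l) \<le> 10 * norm (1 + F)"
    using exponent_bounds[of r l] by simp
  then show "norm (case x of (r, l) \<Rightarrow> exponent r l) \<le>
      10 * norm (case x of (r, l) \<Rightarrow> 1 + real r * (real l * log 2 (real r)))"
    by (simp add: x F_def)
qed

theorem theorem4:
  fixes T :: "nat \<Rightarrow> nat \<Rightarrow> real"
  assumes "\<exists>P. solves_list_allocation P T"
  shows "\<exists>Q (g :: nat \<Rightarrow> nat \<Rightarrow> real).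
    solves_min_max_multiway_cut Q (\<lambda>n l r. 2 powr g r l * T n (r * l)) \<and>
    (\<lambda>(r, l). g r l) \<in> O[principal {(r, l). 2 \<le> r \<and> 2 \<le> l}](\<lambda>(r, l).
      real r * min (real l * log 2 (real r)) (real r * log 2 (real l))) \<and>
    (\<lambda>(r, l). g r l) \<in> O[principal {(r, l). r < 2 \<or> l < 2}](\<lambda>(r, l).
      1 + real r * (real l * log 2 (real r)))"
proof -
  obtain P where P: "solves_list_allocation P T" using assms by blast
  obtain fr where "program P fr" using exists_program by blast
  then interpret program P fr .
  have "2 powr exponent r l = 1000 * real (iterations r l)" for r l
    using iterations_pos[of r l] by (simp add: exponent_def)
  then have "solves_min_max_multiway_cut multiway_cut_program (\<lambda>n l r. 2 powr exponent r l * T n (r * l))"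
    using multiway_cut_program_correct[OF P] unfolding solves_min_max_multiway_cut_def by simp
  then show ?thesis using exponent_bigo_large exponent_bigo_small by blast
qed

end
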